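(* Suppose that $\varphi$ is an analytic self-map of the unit disk $D$, $u\in H(D)$, $0<p<\infty$, and that $\phi$ is normal on $[0,1)$. Then the weighted composition operator $uC_\varphi : H(p,p,\phi)\to\mathcal{B}$ is bounded if and only if both of the following conditions are satisfied: (i) $$\sup_{z\in D}\frac{(1-|z|^2)|u'(z)|}{\phi(|\varphi(z)|)(1-|\varphi(z)|^2)^{1/p}}<\infty;$$ (ii) $$\sup_{z\in D}\frac{(1-|z|^2)|u(z)\varphi'(z)|}{\phi(|\varphi(z)|)(1-|\varphi(z)|^2)^{1+1/p}}<\infty.$$
   Context: $D$ is the open unit disk in $\mathbb{C}$ and $H(D)$ is the class of all analytic functions on $D$. An analytic self-map of $D$ is an analytic function $\varphi:D\to D$. For $u\in H(D)$, the weighted composition operator is $uC_\varphi f=u\cdot(f\circ\varphi)$, $f\in H(D)$. A positive continuous function $\phi$ on $[0,1)$ is called normal if there exist $s,t$ with $0<s<t$ such that $\frac{\phi(r)}{(1-r)^s}\downarrow 0$ and $\frac{\phi(r)}{(1-r)^t}\uparrow\infty$ as $r\to1^-$. For $0<p<\infty$ and normal $\phi$, $H(p,p,\phi)$ is the space of all $f\in H(D)$ such that $\|f\|_{H(p,p,\phi)}=\left(\int_0^1 M_p^p(f,r)\frac{\phi^p(r)}{1-r}\,r\,dr\right)^{1/p}<\infty$, where $M_p(f,r)=\left(\frac1{2\pi}\int_0^{2\pi}|f(re^{i\theta})|^p\,d\theta\right)^{1/p}$, $0\le r<1$ (a norm for $p\ge1$, a quasinorm for $0<p<1$). The Bloch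 space $\mathcal{B}$ is the space of $f\in H(D)$ with $B(f)=\sup_{z\in D}(1-|z|^2)|f'(z)|<\infty$, normed by $\|f\|_{\mathcal{B}}=|f(0)|+B(f)$. A linear operator between such spaces is bounded if it maps the first space into the second and the image of every bounded set is bounded. *)

theory Defs
  imports "HOL-Analysis.Analysis"
begin

abbreviation unit_disk :: "complex set" where
  "unit_disk \<equiv> ball 0 1"

definition analytic_self_map :: "(complex \<Rightarrow> complex) \<Rightarrow> bool" where
  "analytic_self_map \<psi> \<longleftrightarrow> \<psi> holomorphic_on unit_disk \<and> \<psi> ` unit_disk \<subseteq> unit_disk"

definition weighted_comp_op ::
    "(complex \<Rightarrow> complex) \<Rightarrow> (complex \<Rightarrow> complex) \<Rightarrow> (complex \<Rightarrow> complex) \<Rightarrow> complex \<Rightarrow> complex" where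
  "weighted_comp_op u \<psi> f = (\<lambda>z. u z * f (\<psi> z))"

text \<open>As in Shields and Williams, the monotonicity (in the weak sense) is only required
  for \<open>r\<close> close to 1; monotonicity on all of \<open>[0,1)\<close> is the special case \<open>r0 = 0\<close>.\<close>

definition normal_weight :: "(real \<Rightarrow> real) \<Rightarrow> bool" where
  "normal_weight \<phi> \<longleftrightarrow>
     continuous_on {0..<1} \<phi> \<and> (\<forall>r\<in>{0..<1}. \<phi> r > 0) \<and>
     (\<exists>s t r0. 0 < s \<and> s < t \<and> 0 \<le> r0 \<and> r0 < 1 \<and>
        antimono_on {r0..<1} (\<lambda>r. \<phi> r / (1 - r) powr s) \<and>
        ((\<lambda>r. \<phi> r / (1 - r) powr s) \<longlongrightarrow> 0) (at_left 1) \<and>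
        mono_on {r0..<1} (\<lambda>r. \<phi> r / (1 - r) powr t) \<and>
        filterlim (\<lambda>r. \<phi> r / (1 - r) powr t) at_top (at_left 1))"

definition integral_mean :: "real \<Rightarrow> (complex \<Rightarrow> complex) \<Rightarrow> real \<Rightarrow> real" where
  "integral_mean p f r =
     (1 / (2 * pi) * integral {0..2 * pi} (\<lambda>\<theta>. norm (f (of_real r * cis \<theta>)) powr p)) powr (1 / p)"

text \<open>The \<open>p\<close>-th power of the (quasi)norm of \<open>H(p,p,\<phi>)\<close>, with value \<open>\<infinity>\<close> allowed.\<close>

definition Hpp_integral :: "real \<Rightarrow> (real \<Rightarrow> real) \<Rightarrow> (complex \<Rightarrow> complex) \<Rightarrow> ennreal" where
  "Hpp_integral p \<phi> f =
     (\<integral>\<^sup>+ r\<in>{0..<1}. ennreal (integral_mean p f r powr p * (\<phi> r powr p / (1 - r)) * r) \<partial>lborel)"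

definition Hpp_space :: "real \<Rightarrow> (real \<Rightarrow> real) \<Rightarrow> (complex \<Rightarrow> complex) set" where
  "Hpp_space p \<phi> = {f. f holomorphic_on unit_disk \<and> Hpp_integral p \<phi> f < \<infinity>}"

definition Hpp_norm :: "real \<Rightarrow> (real \<Rightarrow> real) \<Rightarrow> (complex \<Rightarrow> complex) \<Rightarrow> real" where
  "Hpp_norm p \<phi> f = enn2real (Hpp_integral p \<phi> f) powr (1 / p)"

definition Bloch_space :: "(complex \<Rightarrow> complex) set" where
  "Bloch_space = {f. f holomorphic_on unit_disk \<and>
     bdd_above ((\<lambda>z. (1 - (norm z)\<^sup>2) * norm (deriv f z)) ` unit_disk)}"

definition Bloch_norm :: "(complex \<Rightarrow> complex) \<Rightarrow> real" where
  "Bloch_norm f = norm (f 0) + (SUP z\<in>unit_disk. (1 - (norm z)\<^sup>2) * norm (deriv f z))"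

definition bounded_operator ::
    "'a set \<Rightarrow> ('a \<Rightarrow> real) \<Rightarrow> 'b set \<Rightarrow> ('b \<Rightarrow> real) \<Rightarrow> ('a \<Rightarrow> 'b) \<Rightarrow> bool" where
  "bounded_operator X nX Y nY T \<longleftrightarrow>
     T ` X \<subseteq> Y \<and>
     (\<forall>S\<subseteq>X. bdd_above (nX ` S) \<longrightarrow> bdd_above (nY ` (T ` S)))"

end

theory Submission
  imports Defs "HOL-Complex_Analysis.Complex_Analysis"
begin

text \<open>
  Write \<open>W w = \<phi> (norm w) * (1 - (norm w)\<^sup>2) powr (1 / p)\<close>. The theorem says that point evaluation and
  evaluation of the derivative at \<open>w\<close>, as functionals on \<open>H(p,p,\<phi>)\<close>, have sizes comparable to
  \<open>1 / W w\<close> and \<open>1 / (W w * (1 - (norm w)\<^sup>2))\<close>, and that the two can be tested independently of each other.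
  The Bloch seminorm of \<open>u * (f \<circ> \<psi>)\<close> involves \<open>u' * (f \<circ> \<psi>) + u * \<psi>' * (f' \<circ> \<psi>)\<close>, and the two
  conditions bound the coefficients of the two evaluations.

  Upper bounds for the evaluations (\<open>Hpp_point_estimates\<close>) give sufficiency. A normal weight lies
  between two powers of \<open>1 - r\<close> in the sense of \<open>normal_weight_comparison\<close>, hence is essentially constant at the scale
  \<open>1 - norm w\<close> around \<open>w\<close>. It is then enough to bound \<open>norm (f w) powr p\<close> by an average of its integral means
  over nearby radii. Instead of the subharmonicity of \<open>norm f powr p\<close>, the lemma
  \<open>shell_lower_bound\<close> uses Cauchy's formula at a point where a weighted supremum of \<open>f\<close> is attained.

  Necessity rests on test functions (\<open>Hpp_test_functions\<close>): for each \<open>w\<close> there are a function with value \<open>1 / W w\<close> and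
  vanishing derivative at \<open>w\<close>, and one with vanishing value and derivative \<open>1 / (W w * (1 - (norm w)\<^sup>2))\<close> there,
  both of norm bounded independently of \<open>w\<close>. They are built from powers of
  \<open>1 / (1 - cnj w * z)\<close>, whose means over circles reduce to the Poisson kernel, and the
  remaining radial integral is split at \<open>norm w\<close>, with the exponent \<open>t\<close> of the weight governing the inner part and
  \<open>s\<close> the outer part (\<open>Hpp_integral_test_function_le\<close>).
\<close>

section \<open>Comparison of the values of a normal weight\<close>

text \<open>Normality of a weight only speaks about radii near 1. On the remaining compact interval a positive
continuous function is pinched between two positive constants, so monotonicity survives on all of
\<open>[0,1)\<close> up to a constant factor. This removes the threshold radius from all later estimates.\<close>

lemma antimono_near_1_imp_almost_antimono:
  fixes h :: "real \<Rightarrow> real"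
  assumes cont: "continuous_on {0..<1} h" and pos: "\<And>r. r \<in> {0..<1} \<Longrightarrow> h r > 0"
    and anti: "antimono_on {r0..<1} h" and r0: "0 \<le> r0" "r0 < 1"
  shows "\<exists>C>0. \<forall>x y. 0 \<le> x \<longrightarrow> x \<le> y \<longrightarrow> y < 1 \<longrightarrow> h y \<le> C * h x"
proof -
  have c0: "continuous_on {0..r0} h"
    by (rule continuous_on_subset[OF cont]) (use r0 in auto)
  obtain a where a: "a \<in> {0..r0}" "\<And>x. x \<in> {0..r0} \<Longrightarrow> h a \<le> h x"
    using continuous_attains_inf[OF _ _ c0] r0 by force
  obtain b where b: "b \<in> {0..r0}" "\<And>x. x \<in> {0..r0} \<Longrightarrow> h x \<le> h b"
    using continuous_attains_sup[OF _ _ c0] r0 by force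
  have ha: "h a > 0" and hb: "h b > 0" using pos a(1) b(1) r0 by auto
  define C where "C = h b / h a"
  have C1: "C \<ge> 1" using a(2)[OF b(1)] ha by (simp add: C_def)
  have low: "h b \<le> C * h x" if "x \<in> {0..r0}" for x
    using a(2)[OF that] ha hb by (simp add: C_def field_simps)
  have "h y \<le> C * h x" if xy: "0 \<le> x" "x \<le> y" "y < 1" for x y
  proof (cases "r0 \<le> x")
    case True
    have "h y \<le> h x" using anti True xy unfolding monotone_on_def by auto
    also have "\<dots> \<le> C * h x" using C1 pos[of x] xy by simp
    finally show ?thesis .
  next
    case False
    have "h y \<le> h b"
    proof (cases "y \<le> r0")
      case True then show ?thesis using b(2) xy by auto
    next
      case False
      have "h y \<le> h r0" using anti False xy r0 unfolding monotone_on_def by auto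
      also have "\<dots> \<le> h b" using b(2) r0 by auto
      finally show ?thesis .
    qed
    also have "\<dots> \<le> C * h x" using low False xy by auto
    finally show ?thesis .
  qed
  then show ?thesis using C1 by (intro exI[of _ C]) auto
qed

text \<open>Up to a constant factor, a normal weight decays on the way to the boundary at least like \<open>(1 - r)\<^sup>s\<close> and at most like \<open>(1 - r)\<^sup>t\<close>.\<close>

lemma normal_weight_comparison:
  assumes "normal_weight \<phi>"
  obtains s t C where "0 < s" "s < t" "0 < C"
    "\<And>x y. 0 \<le> x \<Longrightarrow> x \<le> y \<Longrightarrow> y < 1 \<Longrightarrow> \<phi> y \<le> C * \<phi> x * ((1 - y) / (1 - x)) powr s"
    "\<And>x y. 0 \<le> x \<Longrightarrow> x \<le> y \<Longrightarrow> y < 1 \<Longrightarrow> \<phi> x \<le> C * \<phi> y * ((1 - x) / (1 - y)) powr t"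
proof -
  from assms obtain s t r0 where st: "0 < s" "s < t" and r0: "0 \<le> r0" "r0 < 1"
    and cont: "continuous_on {0..<1} \<phi>" and pos: "\<And>r. r \<in> {0..<1} \<Longrightarrow> \<phi> r > 0"
    and anti: "antimono_on {r0..<1} (\<lambda>r. \<phi> r / (1 - r) powr s)"
    and mono: "mono_on {r0..<1} (\<lambda>r. \<phi> r / (1 - r) powr t)"
    unfolding normal_weight_def by blast
  have "\<exists>C>0. \<forall>x y. 0 \<le> x \<longrightarrow> x \<le> y \<longrightarrow> y < 1 \<longrightarrow> \<phi> y / (1 - y) powr s \<le> C * (\<phi> x / (1 - x) powr s)"
    by (intro antimono_near_1_imp_almost_antimono[OF _ _ anti r0] continuous_intros cont) (auto intro!: divide_pos_pos pos)
  then obtain C1 where C1: "C1 > 0"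
    "\<And>x y. 0 \<le> x \<Longrightarrow> x \<le> y \<Longrightarrow> y < 1 \<Longrightarrow> \<phi> y / (1 - y) powr s \<le> C1 * (\<phi> x / (1 - x) powr s)"
    by blast
  have anti2: "antimono_on {r0..<1} (\<lambda>r. (1 - r) powr t / \<phi> r)"
  proof (rule monotone_onI)
    fix x y assume xy: "x \<in> {r0..<1}" "y \<in> {r0..<1}" "x \<le> y"
    have "\<phi> x / (1 - x) powr t \<le> \<phi> y / (1 - y) powr t"
      using mono xy unfolding monotone_on_def by auto
    then show "(1 - y) powr t / \<phi> y \<le> (1 - x) powr t / \<phi> x"
      using pos[of x] pos[of y] xy r0 by (simp add: field_simps)
  qed
  have "\<exists>C>0. \<forall>x y. 0 \<le> x \<longrightarrow> x \<le> y \<longrightarrow> y < 1 \<longrightarrow> (1 - y) powr t / \<phi> y \<le> C * ((1 - x) powr t / \<phi> x)"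
  proof (rule antimono_near_1_imp_almost_antimono[OF _ _ anti2 r0])
    have "\<phi> r \<noteq> 0" if "r \<in> {0..<1}" for r using pos[OF that] by simp
    then show "continuous_on {0..<1} (\<lambda>r. (1 - r) powr t / \<phi> r)"
      by (intro continuous_intros cont) auto
    show "0 < (1 - r) powr t / \<phi> r" if "r \<in> {0..<1}" for r
      using pos[OF that] that by (intro divide_pos_pos) auto
  qed
  then obtain C2 where C2: "C2 > 0"
    "\<And>x y. 0 \<le> x \<Longrightarrow> x \<le> y \<Longrightarrow> y < 1 \<Longrightarrow> (1 - y) powr t / \<phi> y \<le> C2 * ((1 - x) powr t / \<phi> x)"
    by blast
  define C where "C = max C1 C2"
  show thesis
  proof
    show "0 < s" "s < t" "0 < C" using st C1(1) by (auto simp: C_def)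
    fix x y :: real assume xy: "0 \<le> x" "x \<le> y" "y < 1"
    have p: "\<phi> x > 0" "\<phi> y > 0" using pos xy by auto
    have "\<phi> y \<le> C1 * \<phi> x * ((1 - y) / (1 - x)) powr s"
      using C1(2)[OF xy] xy by (simp add: field_simps powr_divide)
    also have "\<dots> \<le> C * \<phi> x * ((1 - y) / (1 - x)) powr s"
      using p by (intro mult_right_mono) (auto simp: C_def)
    finally show "\<phi> y \<le> C * \<phi> x * ((1 - y) / (1 - x)) powr s" .
    have "\<phi> x \<le> C2 * \<phi> y * ((1 - x) / (1 - y)) powr t"
      using C2(2)[OF xy] xy p by (simp add: field_simps powr_divide)
    also have "\<dots> \<le> C * \<phi> y * ((1 - x) / (1 - y)) powr t"
      using p by (intro mult_right_mono) (auto simp: C_def)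
    finally show "\<phi> x \<le> C * \<phi> y * ((1 - x) / (1 - y)) powr t" .
  qed
qed

lemma normal_weight_pos: "normal_weight \<phi> \<Longrightarrow> 0 \<le> r \<Longrightarrow> r < 1 \<Longrightarrow> \<phi> r > 0"
  by (auto simp: normal_weight_def)

text \<open>If \<open>y\<close> lies further out than \<open>x\<close>, at a comparable distance to the boundary, then the loss permitted by
the exponent \<open>t\<close> is bounded; if it lies further in, then the decay with exponent \<open>s\<close> makes \<open>\<phi> y\<close> the larger
value up to a constant factor.\<close>

lemma normal_weight_local_upper_bound:
  assumes "normal_weight \<phi>"
  obtains C where "0 < C"
    "\<And>x y. 0 \<le> x \<Longrightarrow> x < 1 \<Longrightarrow> 0 \<le> y \<Longrightarrow> (1 - x) / 2 \<le> 1 - y \<Longrightarrow> \<phi> x \<le> C * \<phi> y"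
proof -
  obtain s t C where st: "0 < s" "s < t" "0 < C" and
    s: "\<And>x y. 0 \<le> x \<Longrightarrow> x \<le> y \<Longrightarrow> y < 1 \<Longrightarrow> \<phi> y \<le> C * \<phi> x * ((1 - y) / (1 - x)) powr s" and
    t: "\<And>x y. 0 \<le> x \<Longrightarrow> x \<le> y \<Longrightarrow> y < 1 \<Longrightarrow> \<phi> x \<le> C * \<phi> y * ((1 - x) / (1 - y)) powr t"
    using normal_weight_comparison[OF assms] by blast
  show thesis
  proof
    show "0 < C * 2 powr t" using st by simp
    fix x y :: real assume xy: "0 \<le> x" "x < 1" "0 \<le> y" "(1 - x) / 2 \<le> 1 - y"
    have py: "\<phi> y > 0" using normal_weight_pos[OF assms, of y] xy by auto
    show "\<phi> x \<le> C * 2 powr t * \<phi> y"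
    proof (cases "x \<le> y")
      case True
      have "\<phi> x \<le> C * \<phi> y * ((1 - x) / (1 - y)) powr t" using t True xy by auto
      also have "\<dots> \<le> C * \<phi> y * 2 powr t"
        using xy st py by (intro mult_left_mono powr_mono2) (auto simp: field_simps)
      finally show ?thesis by (simp add: mult_ac)
    next
      case False
      have "\<phi> x \<le> C * \<phi> y * ((1 - x) / (1 - y)) powr s" using s False xy by auto
      also have "\<dots> \<le> C * \<phi> y * 2 powr t"
      proof -
        have "((1 - x) / (1 - y)) powr s \<le> 1 powr s"
          using False xy st by (intro powr_mono2) (auto simp: field_simps)
        also have "\<dots> \<le> 2 powr t" using st by (simp add: ge_one_powr_ge_zero)
        finally show ?thesis using st py by (intro mult_left_mono) auto
      qed
      finally show ?thesis by (simp add: mult_ac)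
    qed
  qed
qed

section \<open>Cauchy estimates on circles\<close>

text \<open>Cauchy's formula in the angular parametrisation used by the integral means.\<close>

lemma Cauchy_integral_formula_cis:
  assumes "continuous_on (cball 0 R) f" "f holomorphic_on ball 0 R" "norm z < R"
  shows "((\<lambda>\<theta>. f (of_real R * cis \<theta>) * (of_real R * cis \<theta>) / (of_real R * cis \<theta> - z))
            has_integral 2 * of_real pi * f z) {0..2 * pi}"
proof -
  have "((\<lambda>u. f u / (u - z)) has_contour_integral (2 * of_real pi * \<i> * f z)) (circlepath 0 R)"
    using Cauchy_integral_circlepath[of 0 R f z] assms by simp
  then have "((\<lambda>\<theta>. f (0 + of_real R * cis \<theta>) / (0 + of_real R * cis \<theta> - z) * of_real R * \<i> * cis \<theta>)
            has_integral (2 * of_real pi * \<i> * f z)) {0..2 * pi}"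
    unfolding circlepath_def by (subst (asm) has_contour_integral_part_circlepath_iff) auto
  from has_integral_mult_right[OF this, of "-\<i>"] show ?thesis
    by (simp add: mult_ac)
qed

lemma continuous_on_circle:
  assumes "f holomorphic_on unit_disk" "0 \<le> R" "R < 1"
  shows "continuous_on A (\<lambda>\<theta>. f (of_real R * cis \<theta>))"
  by (rule continuous_on_compose2[OF holomorphic_on_imp_continuous_on[OF assms(1)]])
     (use assms in \<open>auto intro!: continuous_intros simp: norm_mult\<close>)

lemma continuous_on_circle_powr:
  assumes "f holomorphic_on unit_disk" "0 \<le> R" "R < 1" "0 < p"
  shows "continuous_on A (\<lambda>\<theta>. norm (f (of_real R * cis \<theta>)) powr p)"
  using assms by (intro continuous_on_powr' continuous_intros continuous_on_circle) auto

text \<open>The Cauchy kernel is at most \<open>1 / (R - norm z)\<close> on the circle of radius \<open>R\<close>. Keeping the factor \<open>R\<close> on the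
right is deliberate: it is the factor \<open>r\<close> of the measure defining \<open>H(p,p,\<phi>)\<close>, and so no separate
treatment of points near the origin is needed.\<close>

lemma norm_le_circle_mean:
  assumes f: "f holomorphic_on unit_disk" and R: "norm z < R" "R < 1"
  shows "2 * pi * (R - norm z) * norm (f z)
           \<le> R * integral {0..2 * pi} (\<lambda>\<theta>. norm (f (of_real R * cis \<theta>)))"
proof -
  have R0: "R > 0" using R norm_ge_zero[of z] by linarith
  have cf: "continuous_on (cball 0 R) f"
    by (rule continuous_on_subset[OF holomorphic_on_imp_continuous_on[OF f]]) (use R in auto)
  have hf: "f holomorphic_on ball 0 R"
    by (rule holomorphic_on_subset[OF f]) (use R in auto)
  note * = Cauchy_integral_formula_cis[OF cf hf R(1)]
  have c: "continuous_on {0..2*pi} (\<lambda>\<theta>. norm (f (of_real R * cis \<theta>)))"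
    using continuous_on_circle[OF f, of R] R R0 by (intro continuous_intros) auto
  have "norm (2 * of_real pi * f z)
      \<le> integral {0..2*pi} (\<lambda>\<theta>. R / (R - norm z) * norm (f (of_real R * cis \<theta>)))"
    unfolding integral_unique[OF *, symmetric]
  proof (rule integral_norm_bound_integral)
    fix \<theta> assume "\<theta> \<in> {0..2 * pi}"
    have "R - norm z \<le> norm (of_real R * cis \<theta> - z)"
      using norm_triangle_ineq2[of "of_real R * cis \<theta>" z] R0 by (simp add: norm_mult)
    then have "R * norm (f (of_real R * cis \<theta>)) / norm (of_real R * cis \<theta> - z)
        \<le> R * norm (f (of_real R * cis \<theta>)) / (R - norm z)"
      using R R0 by (intro divide_left_mono mult_pos_pos mult_nonneg_nonneg) auto
    then show "norm (f (of_real R * cis \<theta>) * (of_real R * cis \<theta>) / (of_real R * cis \<theta> - z))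
        \<le> R / (R - norm z) * norm (f (of_real R * cis \<theta>))"
      using R0 by (simp add: norm_mult norm_divide mult_ac)
  next
    show "(\<lambda>\<theta>. R / (R - norm z) * norm (f (of_real R * cis \<theta>))) integrable_on {0..2 * pi}"
      by (intro integrable_continuous_real continuous_intros c)
  qed (use * in blast)
  also have "\<dots> = R / (R - norm z) * integral {0..2*pi} (\<lambda>\<theta>. norm (f (of_real R * cis \<theta>)))"
    by simp
  finally show ?thesis using R by (simp add: norm_mult field_simps)
qed

section \<open>A substitute for the sub-mean value property\<close>

lemma power_powr_divide:
  fixes x :: real
  assumes "0 \<le> x" "0 < n"
  shows "(x ^ n) powr (p / real n) = x powr p"
  using assms by (cases "x = 0") (auto simp: powr_powr simp flip: powr_realpow)

text \<open>This replaces the subharmonicity of \<open>norm f powr p\<close>. For \<open>p = 1\<close> the Cauchy bound would do; for smaller \<open>p\<close> one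
writes \<open>norm f = norm f powr (1 - p) * norm f powr p\<close> and has to control the first factor by a supremum.
The supremum to use is that of \<open>(\<rho> - norm z) powr (2 / p) * norm (f z)\<close> over the shell
\<open>norm w \<le> norm z \<le> \<rho>\<close>. At a maximiser \<open>z\<close>, with distance \<open>d\<close> to the outer circle, the values of \<open>f\<close> at radii from
\<open>norm z\<close> to \<open>norm z + d / 2\<close> exceed \<open>norm (f z)\<close> by a constant factor at most, so every circle with radius in an
interval of length \<open>d / 4\<close> carries a mean of size at least a constant times \<open>d * norm (f z) powr p\<close>; and
\<open>d\<^sup>2 * norm (f z) powr p\<close> dominates the same quantity at \<open>w\<close> by maximality.

The conclusion is stated as a constant lower bound \<open>K\<close> on an interval of radii, not as a
bound by an integral over the radius, so that measurability of the integral means never enters.\<close>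

lemma shell_lower_bound_le_1:
  assumes f: "f holomorphic_on unit_disk" and p: "0 < p" "p \<le> 1"
    and w: "norm w < \<rho>" "\<rho> < 1"
  shows "\<exists>a b K. norm w \<le> a \<and> a < b \<and> b \<le> \<rho> \<and> 0 \<le> K \<and>
    (\<forall>R\<in>{a..b}. K \<le> R * integral {0..2 * pi} (\<lambda>\<theta>. norm (f (of_real R * cis \<theta>)) powr p)) \<and>
    2 * pi / 16 / (2 powr (2 / p)) powr (1 - p) * (norm (f w) powr p * (\<rho> - norm w)\<^sup>2) \<le> K * (b - a)"
proof (cases "f w = 0")
  case True
  have "0 \<le> R * integral {0..2 * pi} (\<lambda>\<theta>. norm (f (of_real R * cis \<theta>)) powr p)"
    if "R \<in> {norm w..\<rho>}" for R
    using that w norm_ge_zero[of w]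
    by (intro mult_nonneg_nonneg integral_nonneg integrable_continuous_real continuous_on_circle_powr f p)
       (auto simp del: norm_ge_zero)
  then show ?thesis using True w by (intro exI[of _ "norm w"] exI[of _ \<rho>] exI[of _ 0]) auto
next
  case False
  define A where "A = {z::complex. norm w \<le> norm z \<and> norm z \<le> \<rho>}"
  \<comment> \<open>The exponent makes the \<open>p\<close>-th power of \<open>H z\<close> equal to \<open>(\<rho> - norm z)\<^sup>2 * norm (f z) powr p\<close>.\<close>
  define H where "H = (\<lambda>z. (\<rho> - norm z) powr (2 / p) * norm (f z))"
  have "A = cball 0 \<rho> - ball 0 (norm w)" by (auto simp: A_def)
  then have cA: "compact A" by (auto intro: compact_diff)
  have cf: "continuous_on A f"
    by (rule continuous_on_subset[OF holomorphic_on_imp_continuous_on[OF f]]) (use w in \<open>auto simp: A_def\<close>)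
  have cH: "continuous_on A H"
    unfolding H_def using p by (intro continuous_intros cf continuous_on_powr') (auto simp: A_def)
  have wA: "w \<in> A" using w by (auto simp: A_def)
  obtain z where z: "z \<in> A" "\<And>x. x \<in> A \<Longrightarrow> H x \<le> H z"
    using continuous_attains_sup[OF cA _ cH] wA by blast
  have Hw: "H w > 0" using False w by (auto simp: H_def)
  with z(2)[OF wA] have Hz: "H z > 0" by simp
  define d where "d = \<rho> - norm z"
  define F where "F = norm (f z)"
  have d: "d > 0" using Hz z(1) by (cases "norm z = \<rho>") (auto simp: H_def d_def A_def)
  have F: "F > 0" using Hz by (auto simp: H_def F_def)
  have wz: "norm w \<le> norm z" using z by (auto simp: A_def)
  define B where "B = 2 powr (2 / p)"
  have B: "B > 0" by (simp add: B_def)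
  define M where "M = F * B"
  have M: "M > 0" using F B by (simp add: M_def)
  have fM: "norm (f x) \<le> M" if x: "norm z \<le> norm x" "norm x \<le> \<rho> - d / 2" for x
  proof -
    have "x \<in> A" using x wz d by (auto simp: A_def)
    then have "H x \<le> d powr (2 / p) * F" using z(2) by (simp add: H_def d_def F_def)
    moreover have "(d / 2) powr (2 / p) * norm (f x) \<le> H x"
      unfolding H_def using x d p by (intro mult_right_mono powr_mono2) auto
    ultimately have "(d / 2) powr (2 / p) * norm (f x) \<le> d powr (2 / p) * F" by linarith
    moreover have "(d / 2) powr (2 / p) = d powr (2/p) / B"
      using d by (simp add: B_def powr_divide)
    ultimately show ?thesis using d B by (simp add: M_def field_simps)
  qed
  define K where "K = 2 * pi * (d / 4) * F / M powr (1 - p)"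
  \<comment> \<open>Radii in \<open>{a..b}\<close> keep a distance of at least \<open>d / 4\<close> from \<open>norm z\<close>, for the Cauchy kernel, and of at least \<open>d / 2\<close> from \<open>\<rho>\<close>, for the bound \<open>M\<close>.\<close>
  define a where "a = norm z + d / 4"
  define b where "b = norm z + d / 2"
  have "K \<le> R * integral {0..2 * pi} (\<lambda>\<theta>. norm (f (of_real R * cis \<theta>)) powr p)"
    if R: "R \<in> {a..b}" for R
  proof -
    have R1: "0 < R" "R < 1" "norm z < R"
    proof -
      have "norm z + d / 4 \<le> R" "R \<le> norm z + d / 2" "norm z + d = \<rho>"
        using R by (auto simp: a_def b_def d_def)
      then show "0 < R" "R < 1" "norm z < R" using w d norm_ge_zero[of z] by linarith+
    qed
    have "2 * pi * (d / 4) * F \<le> 2 * pi * (R - norm z) * F"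
      using R F unfolding a_def by (intro mult_right_mono mult_left_mono) auto
    also have "\<dots> \<le> R * integral {0..2 * pi} (\<lambda>\<theta>. norm (f (of_real R * cis \<theta>)))"
      using norm_le_circle_mean[OF f, of z R] R1 by (simp add: F_def)
    also have "\<dots> \<le> R * integral {0..2 * pi} (\<lambda>\<theta>. M powr (1 - p) * norm (f (of_real R * cis \<theta>)) powr p)"
    proof (intro mult_left_mono integral_le)
      show "(\<lambda>\<theta>. norm (f (of_real R * cis \<theta>))) integrable_on {0..2 * pi}"
        using R1 by (intro integrable_continuous_real continuous_on_norm continuous_on_circle f) auto
      show "(\<lambda>\<theta>. M powr (1 - p) * norm (f (of_real R * cis \<theta>)) powr p) integrable_on {0..2 * pi}"
        using R1 by (intro integrable_continuous_real continuous_on_mult_left continuous_on_circle_powr f p) auto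
      fix \<theta> assume "\<theta> \<in> {0..2 * pi}"
      define x where "x = norm (f (of_real R * cis \<theta>))"
      have xM: "x \<le> M" unfolding x_def
        using R R1 by (intro fM) (auto simp: norm_mult a_def b_def d_def field_simps)
      have "x \<le> M powr (1 - p) * x powr p"
      proof (cases "x = 0")
        case False
        then have x0: "x > 0" by (simp add: x_def)
        have "x = x powr (1 - p) * x powr p" using x0 by (simp flip: powr_add)
        also have "\<dots> \<le> M powr (1 - p) * x powr p"
          using x0 xM p by (intro mult_right_mono powr_mono2) auto
        finally show ?thesis .
      qed simp
      then show "norm (f (of_real R * cis \<theta>)) \<le> M powr (1 - p) * norm (f (of_real R * cis \<theta>)) powr p"
        by (simp add: x_def)
    qed (use R1 in auto)
    also have "\<dots> = M powr (1 - p) * (R * integral {0..2 * pi} (\<lambda>\<theta>. norm (f (of_real R * cis \<theta>)) powr p))"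
      by simp
    finally show ?thesis using M by (simp add: K_def field_simps)
  qed
  moreover have "2 * pi / 16 / B powr (1 - p) * (norm (f w) powr p * (\<rho> - norm w)\<^sup>2) \<le> K * (b - a)"
  proof -
    have pw: "(x powr (2 / p) * y) powr p = y powr p * x\<^sup>2" if "x > 0" "y \<ge> 0" for x y :: real
      using that p by (simp add: powr_mult powr_powr powr_numeral)
    have "H w powr p \<le> H z powr p" using z(2)[OF wA] Hw p by (intro powr_mono2) auto
    then have *: "norm (f w) powr p * (\<rho> - norm w)\<^sup>2 \<le> F powr p * d\<^sup>2"
      using pw[of "\<rho> - norm w" "norm (f w)"] pw[of d F] w d F by (simp add: H_def F_def d_def)
    have "F / F powr (1 - p) = F powr p"
      using F powr_diff[of F 1 "1 - p"] by simp
    then have "K * (b - a) = 2 * pi / 16 / B powr (1 - p) * (F powr p * d\<^sup>2)"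
      using F B by (simp add: K_def M_def a_def b_def powr_mult power2_eq_square field_simps)
    then show ?thesis using * B by (simp add: mult_left_mono divide_right_mono)
  qed
  moreover have "norm w \<le> a" "a < b" "b \<le> \<rho>"
  proof -
    have "norm z + d = \<rho>" by (simp add: d_def)
    then show "norm w \<le> a" "a < b" "b \<le> \<rho>" using wz d unfolding a_def b_def by linarith+
  qed
  moreover have "0 \<le> K" using d F M by (simp add: K_def)
  ultimately show ?thesis unfolding B_def by blast
qed

text \<open>Exponents above 1 reduce to exponents at most 1 by passing from \<open>f\<close> to a power \<open>f ^ n\<close>, because
\<open>norm (f ^ n) powr (p / n) = norm f powr p\<close>.\<close>

lemma shell_lower_bound:
  assumes p: "0 < p"
  obtains c where "0 < c"
    "\<And>f (w::complex) \<rho>. f holomorphic_on unit_disk \<Longrightarrow> norm w < \<rho> \<Longrightarrow> \<rho> < 1 \<Longrightarrow>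
      \<exists>a b K. norm w \<le> a \<and> a < b \<and> b \<le> \<rho> \<and> 0 \<le> K \<and>
        (\<forall>R\<in>{a..b}. K \<le> R * integral {0..2 * pi} (\<lambda>\<theta>. norm (f (of_real R * cis \<theta>)) powr p)) \<and>
        c * (norm (f w) powr p * (\<rho> - norm w)\<^sup>2) \<le> K * (b - a)"
proof -
  define n where "n = nat \<lceil>p\<rceil>"
  define q where "q = p / real n"
  have n: "n > 0" using p by (simp add: n_def)
  have "p \<le> real n" unfolding n_def by linarith
  then have q: "0 < q" "q \<le> 1" using n p by (auto simp: q_def)
  have eq: "norm (z ^ n) powr q = norm z powr p" for z :: complex
    unfolding q_def norm_power by (rule power_powr_divide) (use n in auto)
  show thesis
  proof
    show "0 < 2 * pi / 16 / (2 powr (2 / q)) powr (1 - q)" by simp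
    fix f :: "complex \<Rightarrow> complex" and w :: complex and \<rho> :: real
    assume f: "f holomorphic_on unit_disk" and w: "norm w < \<rho>" "\<rho> < 1"
    have "(\<lambda>z. f z ^ n) holomorphic_on unit_disk" using f by (intro holomorphic_intros)
    from shell_lower_bound_le_1[OF this q w] show
      "\<exists>a b K. norm w \<le> a \<and> a < b \<and> b \<le> \<rho> \<and> 0 \<le> K \<and>
        (\<forall>R\<in>{a..b}. K \<le> R * integral {0..2 * pi} (\<lambda>\<theta>. norm (f (of_real R * cis \<theta>)) powr p)) \<and>
        2 * pi / 16 / (2 powr (2 / q)) powr (1 - q) * (norm (f w) powr p * (\<rho> - norm w)\<^sup>2) \<le> K * (b - a)"
      unfolding eq .
  qed
qed

section \<open>Point estimates\<close>

lemma integral_mean_powr: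
  assumes "f holomorphic_on unit_disk" "0 \<le> r" "r < 1" "0 < p"
  shows "integral_mean p f r powr p
    = 1 / (2 * pi) * integral {0..2 * pi} (\<lambda>\<theta>. norm (f (of_real r * cis \<theta>)) powr p)"
proof -
  have "0 \<le> integral {0..2 * pi} (\<lambda>\<theta>. norm (f (of_real r * cis \<theta>)) powr p)"
    by (intro integral_nonneg integrable_continuous_real continuous_on_circle_powr assms) auto
  then show ?thesis using assms unfolding integral_mean_def by (simp add: powr_powr)
qed

lemma Hpp_integral_ge_shell:
  assumes f: "f holomorphic_on unit_disk" and p: "0 < p"
    and ab: "0 \<le> a" "a \<le> b" "b < 1" and nn: "0 \<le> K" "0 \<le> m"
    and K: "\<And>R. R \<in> {a..b} \<Longrightarrow> K \<le> R * integral {0..2 * pi} (\<lambda>\<theta>. norm (f (of_real R * cis \<theta>)) powr p)"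
    and m: "\<And>R. R \<in> {a..b} \<Longrightarrow> m \<le> \<phi> R powr p / (1 - R)"
  shows "ennreal (K / (2 * pi) * m * (b - a)) \<le> Hpp_integral p \<phi> f"
proof -
  have "ennreal (K / (2 * pi) * m * (b - a)) = (\<integral>\<^sup>+ r. ennreal (K / (2 * pi) * m) * indicator {a..b} r \<partial>lborel)"
    using ab nn by (subst nn_integral_cmult_indicator) (auto simp flip: ennreal_mult)
  also have "\<dots> \<le> Hpp_integral p \<phi> f"
    unfolding Hpp_integral_def
  proof (rule nn_integral_mono)
    fix R
    show "ennreal (K / (2 * pi) * m) * indicator {a..b} R
      \<le> ennreal (integral_mean p f R powr p * (\<phi> R powr p / (1 - R)) * R) * indicator {0..<1} R"
    proof (cases "R \<in> {a..b}")
      case True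
      then have R: "0 \<le> R" "R < 1" using ab by auto
      have "K / (2 * pi) * m \<le> (R * integral {0..2 * pi} (\<lambda>\<theta>. norm (f (of_real R * cis \<theta>)) powr p)) / (2 * pi)
          * (\<phi> R powr p / (1 - R))"
        using K[OF True] m[OF True] nn by (intro mult_mono divide_right_mono) auto
      also have "\<dots> = integral_mean p f R powr p * (\<phi> R powr p / (1 - R)) * R"
        by (simp add: integral_mean_powr[OF f R p])
      finally show ?thesis using True R by (simp add: ennreal_leI)
    qed auto
  qed
  finally show ?thesis .
qed

text \<open>On the shell between the radii \<open>r = norm w\<close> and \<open>(1 + r) / 2\<close> the density of the norm is at least a
constant times \<open>\<phi> r powr p / (1 - r)\<close>, and the shell bound supplies a further \<open>(1 - r)\<^sup>2\<close>. The powers combine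
to \<open>norm (f w) powr p * \<phi> r powr p * (1 - r)\<close>, which is thus bounded by the \<open>p\<close>-th power of the norm.\<close>

lemma Hpp_point_estimate_radial:
  assumes p: "0 < p" and \<phi>: "normal_weight \<phi>"
  obtains C where "0 < C"
    "\<And>f w. f \<in> Hpp_space p \<phi> \<Longrightarrow> norm w < 1 \<Longrightarrow>
      norm (f w) \<le> C * Hpp_norm p \<phi> f / (\<phi> (norm w) * (1 - norm w) powr (1 / p))"
proof -
  obtain c where c: "0 < c" and shell: "\<And>f (w::complex) \<rho>. f holomorphic_on unit_disk \<Longrightarrow> norm w < \<rho> \<Longrightarrow> \<rho> < 1 \<Longrightarrow>
      \<exists>a b K. norm w \<le> a \<and> a < b \<and> b \<le> \<rho> \<and> 0 \<le> K \<and>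
        (\<forall>R\<in>{a..b}. K \<le> R * integral {0..2 * pi} (\<lambda>\<theta>. norm (f (of_real R * cis \<theta>)) powr p)) \<and>
        c * (norm (f w) powr p * (\<rho> - norm w)\<^sup>2) \<le> K * (b - a)"
    using shell_lower_bound[OF p] by blast
  obtain C0 where C0: "0 < C0" and cmp:
    "\<And>x y. 0 \<le> x \<Longrightarrow> x < 1 \<Longrightarrow> 0 \<le> y \<Longrightarrow> (1 - x) / 2 \<le> 1 - y \<Longrightarrow> \<phi> x \<le> C0 * \<phi> y"
    using normal_weight_local_upper_bound[OF \<phi>] by blast
  define c' where "c' = c / (8 * pi * C0 powr p)"
  have c': "c' > 0" using c C0 by (simp add: c'_def)
  show thesis
  proof
    show "0 < (1 / c') powr (1 / p)" using c' by simp
    fix f w assume f: "f \<in> Hpp_space p \<phi>" and w: "norm (w::complex) < 1"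
    have hol: "f holomorphic_on unit_disk" and fin: "Hpp_integral p \<phi> f < \<infinity>"
      using f by (auto simp: Hpp_space_def)
    define r where "r = norm w"
    have r: "0 \<le> r" "r < 1" using w by (auto simp: r_def)
    have pr: "\<phi> r > 0" using normal_weight_pos[OF \<phi> r] .
    obtain a b K where ab: "r \<le> a" "a < b" "b \<le> (1 + r) / 2" "0 \<le> K"
      and K: "\<And>R. R\<in>{a..b} \<Longrightarrow> K \<le> R * integral {0..2 * pi} (\<lambda>\<theta>. norm (f (of_real R * cis \<theta>)) powr p)"
      and Kab: "c * (norm (f w) powr p * ((1 + r) / 2 - r)\<^sup>2) \<le> K * (b - a)"
      using shell[OF hol, of w "(1 + r) / 2"] r unfolding r_def by auto
    define m where "m = (\<phi> r / C0) powr p / (1 - r)"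
    have m0: "m \<ge> 0" using r by (simp add: m_def)
    have m: "m \<le> \<phi> R powr p / (1 - R)" if R: "R \<in> {a..b}" for R
    proof -
      have "\<phi> r \<le> C0 * \<phi> R" by (rule cmp) (use R ab r in auto)
      then have "\<phi> r / C0 \<le> \<phi> R" using C0 by (simp add: field_simps)
      then show ?thesis unfolding m_def using R ab r pr C0 p
        by (intro frac_le powr_mono2) auto
    qed
    have le: "ennreal (K / (2 * pi) * m * (b - a)) \<le> Hpp_integral p \<phi> f"
      by (rule Hpp_integral_ge_shell[OF hol p _ _ _ ab(4) m0 K m]) (use ab r in auto)
    define J where "J = enn2real (Hpp_integral p \<phi> f)"
    have J: "Hpp_integral p \<phi> f = ennreal J" "J \<ge> 0" using fin by (auto simp: J_def)
    have "c' * (norm (f w) powr p * \<phi> r powr p * (1 - r))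
        = c * (norm (f w) powr p * ((1 + r) / 2 - r)\<^sup>2) * m / (2 * pi)"
    proof -
      have "(1 + r) / 2 - r = (1 - r) / 2" by (simp add: field_simps)
      then show ?thesis using r C0 pr
        by (simp add: c'_def m_def powr_divide power2_eq_square field_simps)
    qed
    also have "\<dots> \<le> K * (b - a) * m / (2 * pi)"
      using Kab m0 by (intro divide_right_mono mult_right_mono) auto
    also have "\<dots> = K / (2 * pi) * m * (b - a)" by simp
    also have "\<dots> \<le> J" using le J by simp
    finally have "norm (f w) powr p * \<phi> r powr p * (1 - r) \<le> 1 / c' * J"
      using c' by (simp add: field_simps)
    then have "(norm (f w) powr p * \<phi> r powr p * (1 - r)) powr (1 / p) \<le> (1 / c' * J) powr (1 / p)"
      using r p by (intro powr_mono2) auto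
    moreover have "(norm (f w) powr p * \<phi> r powr p * (1 - r)) powr (1 / p) = norm (f w) * \<phi> r * (1 - r) powr (1 / p)"
      using r p pr by (simp add: powr_mult powr_powr)
    moreover have "(1 / c' * J) powr (1 / p) = (1 / c') powr (1 / p) * Hpp_norm p \<phi> f"
      using c' J(2) by (simp add: powr_mult Hpp_norm_def J_def powr_divide)
    ultimately have "norm (f w) * \<phi> r * (1 - r) powr (1 / p) \<le> (1 / c') powr (1 / p) * Hpp_norm p \<phi> f"
      by simp
    then show "norm (f w) \<le> (1 / c') powr (1 / p) * Hpp_norm p \<phi> f / (\<phi> (norm w) * (1 - norm w) powr (1 / p))"
      using r pr unfolding r_def[symmetric] by (simp add: field_simps)
  qed
qed

text \<open>The bound for the derivative follows from the one for \<open>f\<close> by Cauchy's inequality on the circle of radius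
\<open>(1 - norm w) / 2\<close> about \<open>w\<close>, where the weight is at least a constant times \<open>\<phi> (norm w)\<close>. The estimates are phrased with
\<open>1 - (norm w)\<^sup>2\<close>, the quantity in the two conditions of the theorem.\<close>

lemma Hpp_point_estimates:
  assumes p: "0 < p" and \<phi>: "normal_weight \<phi>"
  obtains C where "0 < C"
    "\<And>f w. f \<in> Hpp_space p \<phi> \<Longrightarrow> norm w < 1 \<Longrightarrow>
      norm (f w) \<le> C * Hpp_norm p \<phi> f / (\<phi> (norm w) * (1 - (norm w)\<^sup>2) powr (1 / p))"
    "\<And>f w. f \<in> Hpp_space p \<phi> \<Longrightarrow> norm w < 1 \<Longrightarrow>
      norm (deriv f w) \<le> C * Hpp_norm p \<phi> f / (\<phi> (norm w) * (1 - (norm w)\<^sup>2) powr (1 + 1 / p))"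
proof -
  obtain C where C: "0 < C" and pt: "\<And>f w. f \<in> Hpp_space p \<phi> \<Longrightarrow> norm w < 1 \<Longrightarrow>
      norm (f w) \<le> C * Hpp_norm p \<phi> f / (\<phi> (norm w) * (1 - norm w) powr (1 / p))"
    using Hpp_point_estimate_radial[OF assms] by blast
  obtain C0 where C0: "0 < C0" and cmp:
    "\<And>x y. 0 \<le> x \<Longrightarrow> x < 1 \<Longrightarrow> 0 \<le> y \<Longrightarrow> (1 - x) / 2 \<le> 1 - y \<Longrightarrow> \<phi> x \<le> C0 * \<phi> y"
    using normal_weight_local_upper_bound[OF \<phi>] by blast
  have N0: "0 \<le> Hpp_norm p \<phi> f" for f by (simp add: Hpp_norm_def)
  \<comment> \<open>The factors \<open>1 - r\<close> and \<open>1 - r\<^sup>2\<close> differ by a factor between 1 and 2.\<close>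
  have sq: "x / (1 - r) powr e \<le> 2 powr e * x / (1 - r\<^sup>2) powr e"
    if "0 \<le> r" "r < 1" "e > 0" "x \<ge> 0" for r e x :: real
  proof -
    have "(1 - r\<^sup>2) = (1 - r) * (1 + r)" by (simp add: power2_eq_square algebra_simps)
    also have "\<dots> \<le> (1 - r) * 2" using that by (intro mult_left_mono) auto
    finally have "(1 - r\<^sup>2) powr e \<le> ((1 - r) * 2) powr e"
      using that by (intro powr_mono2) (auto simp: power_le_one)
    also have "\<dots> = (1 - r) powr e * 2 powr e" using that by (subst powr_mult) auto
    finally have le: "(1 - r\<^sup>2) powr e \<le> (1 - r) powr e * 2 powr e" .
    have pos: "(1 - r\<^sup>2) powr e > 0" using that abs_square_less_1[of r] by auto
    from le have "x * (1 - r\<^sup>2) powr e \<le> x * ((1 - r) powr e * 2 powr e)"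
      using that by (intro mult_left_mono)
    then show ?thesis using pos that by (simp add: field_simps)
  qed
  define D1 where "D1 = C * 2 powr (1 / p)"
  define D2 where "D2 = 2 * C * C0 * 2 powr (1 / p) * 2 powr (1 + 1 / p)"
  have D: "D1 > 0" "D2 > 0" using C C0 by (auto simp: D1_def D2_def)
  have e1: "norm (f w) \<le> D1 * Hpp_norm p \<phi> f / (\<phi> (norm w) * (1 - (norm w)\<^sup>2) powr (1 / p))"
    if f: "f \<in> Hpp_space p \<phi>" and w: "norm w < 1" for f w
  proof -
    have "norm (f w) \<le> C * Hpp_norm p \<phi> f / \<phi> (norm w) / (1 - norm w) powr (1 / p)"
      using pt[OF f w] by simp
    also have "\<dots> \<le> 2 powr (1 / p) * (C * Hpp_norm p \<phi> f / \<phi> (norm w)) / (1 - (norm w)\<^sup>2) powr (1 / p)"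
      using w p C N0 normal_weight_pos[OF \<phi>, of "norm w"]
      by (intro sq divide_nonneg_pos mult_nonneg_nonneg) auto
    finally show ?thesis by (simp add: D1_def mult_ac)
  qed
  have e2: "norm (deriv f w) \<le> D2 * Hpp_norm p \<phi> f / (\<phi> (norm w) * (1 - (norm w)\<^sup>2) powr (1 + 1 / p))"
    if f: "f \<in> Hpp_space p \<phi>" and w: "norm w < 1" for f w
  proof -
    define r where "r = norm w"
    have r: "0 \<le> r" "r < 1" using w by (auto simp: r_def)
    have pr: "\<phi> r > 0" using normal_weight_pos[OF \<phi> r] .
    define \<delta> where "\<delta> = (1 - r) / 2"
    have \<delta>: "\<delta> > 0" using r by (simp add: \<delta>_def)
    define N where "N = Hpp_norm p \<phi> f"
    define B where "B = C * C0 * 2 powr (1 / p) * N / (\<phi> r * (1 - r) powr (1 / p))"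
    have hol: "f holomorphic_on unit_disk" using f by (auto simp: Hpp_space_def)
    have sub: "cball w \<delta> \<subseteq> unit_disk"
    proof
      fix x assume "x \<in> cball w \<delta>"
      then have "norm x \<le> r + \<delta>"
        using norm_triangle_ineq2[of x w] by (auto simp: dist_norm norm_minus_commute r_def)
      then show "x \<in> unit_disk" using r by (auto simp: \<delta>_def field_simps)
    qed
    have "norm ((deriv ^^ 1) f w) \<le> fact 1 * B / \<delta> ^ 1"
    proof (rule Cauchy_inequality)
      show "f holomorphic_on ball w \<delta>"
        by (rule holomorphic_on_subset[OF hol]) (use sub in auto)
      show "continuous_on (cball w \<delta>) f"
        by (rule continuous_on_subset[OF holomorphic_on_imp_continuous_on[OF hol] sub])
      show "0 < \<delta>" by fact
      fix x assume x: "norm (w - x) = \<delta>"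
      have "norm x \<le> r + \<delta>"
        using norm_triangle_ineq2[of x w] x by (auto simp: norm_minus_commute r_def)
      then have x1: "\<delta> \<le> 1 - norm x" by (simp add: \<delta>_def field_simps)
      then have nx: "norm x < 1" using \<delta> by simp
      have px: "\<phi> (norm x) > 0" using normal_weight_pos[OF \<phi> _ nx] by simp
      have c: "\<phi> r \<le> C0 * \<phi> (norm x)" by (rule cmp) (use r x1 in \<open>auto simp: \<delta>_def\<close>)
      have "\<delta> powr (1 / p) \<le> (1 - norm x) powr (1 / p)"
        using x1 \<delta> p by (intro powr_mono2) auto
      then have d: "\<phi> r * \<delta> powr (1 / p) \<le> C0 * \<phi> (norm x) * (1 - norm x) powr (1 / p)"
        using c pr \<delta> px C0 by (intro mult_mono) auto
      have "norm (f x) \<le> C * N / (\<phi> (norm x) * (1 - norm x) powr (1 / p))"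
        unfolding N_def by (rule pt[OF f nx])
      also have "\<dots> = C * C0 * N / (C0 * \<phi> (norm x) * (1 - norm x) powr (1 / p))"
        using C0 by simp
      also have "\<dots> \<le> C * C0 * N / (\<phi> r * \<delta> powr (1 / p))"
        using d pr px \<delta> C C0 N0 nx by (intro divide_left_mono mult_pos_pos mult_nonneg_nonneg) (auto simp: N_def)
      also have "\<dots> = B" using r by (simp add: B_def \<delta>_def powr_divide)
      finally show "norm (f x) \<le> B" .
    qed
    then have "norm (deriv f w) \<le> 2 * B / (1 - r)" by (simp add: \<delta>_def field_simps)
    also have "\<dots> = 2 * C * C0 * 2 powr (1 / p) * N / \<phi> r / (1 - r) powr (1 + 1 / p)"
      using r by (simp add: B_def powr_add mult_ac)
    also have "\<dots> \<le> 2 powr (1 + 1 / p) * (2 * C * C0 * 2 powr (1 / p) * N / \<phi> r) / (1 - r\<^sup>2) powr (1 + 1 / p)"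
      using r p C C0 N0 pr by (intro sq divide_nonneg_pos mult_nonneg_nonneg) (auto simp: N_def add_pos_pos)
    finally show ?thesis by (simp add: D2_def N_def r_def mult_ac)
  qed
  show thesis
  proof
    show "0 < D1 + D2" using D by simp
    fix f w assume f: "f \<in> Hpp_space p \<phi>" and w: "norm (w::complex) < 1"
    have pw: "\<phi> (norm w) > 0" using normal_weight_pos[OF \<phi> _ w] by simp
    note e1[OF f w]
    also have "D1 * Hpp_norm p \<phi> f / (\<phi> (norm w) * (1 - (norm w)\<^sup>2) powr (1 / p))
      \<le> (D1 + D2) * Hpp_norm p \<phi> f / (\<phi> (norm w) * (1 - (norm w)\<^sup>2) powr (1 / p))"
      using D N0 pw by (intro divide_right_mono mult_right_mono) auto
    finally show "norm (f w) \<le> \<dots>" .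
    note e2[OF f w]
    also have "D2 * Hpp_norm p \<phi> f / (\<phi> (norm w) * (1 - (norm w)\<^sup>2) powr (1 + 1 / p))
      \<le> (D1 + D2) * Hpp_norm p \<phi> f / (\<phi> (norm w) * (1 - (norm w)\<^sup>2) powr (1 + 1 / p))"
      using D N0 pw by (intro divide_right_mono mult_right_mono) auto
    finally show "norm (deriv f w) \<le> \<dots>" .
  qed
qed

section \<open>Integrals of kernels\<close>

lemma one_minus_mult_neq_0:
  fixes v x :: complex
  assumes "norm v < 1" "norm x \<le> 1"
  shows "1 - v * x \<noteq> 0"
proof
  assume "1 - v * x = 0"
  then have "norm v * norm x = 1" by (metis eq_iff_diff_eq_0 norm_mult norm_one)
  moreover have "norm v * norm x \<le> norm v * 1" using assms by (intro mult_left_mono) auto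
  ultimately show False using assms by linarith
qed

text \<open>The Poisson kernel has total mass 1. This is Cauchy's formula on the unit circle for
\<open>1 / (1 - v * \<zeta>)\<close> at the point \<open>cnj v\<close>, since \<open>\<zeta> - cnj v = \<zeta> * cnj (1 - v * \<zeta>)\<close> when \<open>norm \<zeta> = 1\<close>.\<close>

lemma integral_circle_inverse_square:
  assumes v: "norm v < 1"
  shows "((\<lambda>\<theta>. 1 / (norm (1 - v * cis \<theta>))\<^sup>2) has_integral 2 * pi / (1 - (norm v)\<^sup>2)) {0..2 * pi}"
proof -
  have "((\<lambda>\<theta>. 1 / (1 - v * (of_real 1 * cis \<theta>)) * (of_real 1 * cis \<theta>) / (of_real 1 * cis \<theta> - cnj v))
      has_integral 2 * of_real pi * (1 / (1 - v * cnj v))) {0..2 * pi}"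
    by (rule Cauchy_integral_formula_cis)
       (use v one_minus_mult_neq_0[OF v] in \<open>auto intro!: continuous_intros holomorphic_intros\<close>)
  moreover have "1 / (1 - v * (of_real 1 * cis \<theta>)) * (of_real 1 * cis \<theta>) / (of_real 1 * cis \<theta> - cnj v)
      = of_real (1 / (norm (1 - v * cis \<theta>))\<^sup>2)" for \<theta>
  proof -
    have "cis \<theta> - cnj v = cis \<theta> * cnj (1 - v * cis \<theta>)"
      by (simp add: algebra_simps cis_cnj cis_mult)
    then show ?thesis
      by (simp add: complex_norm_square del: of_real_power complex_cnj_diff)
  qed
  moreover have "2 * of_real pi * (1 / (1 - v * cnj v)) = of_real (2 * pi / (1 - (norm v)\<^sup>2))"
    by (simp add: complex_norm_square del: of_real_power)
  ultimately have "((\<lambda>\<theta>. complex_of_real (1 / (norm (1 - v * cis \<theta>))\<^sup>2))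
      has_integral of_real (2 * pi / (1 - (norm v)\<^sup>2))) {0..2 * pi}" by simp
  from has_integral_linear[OF this bounded_linear_Re] show ?thesis by (simp add: o_def)
qed

text \<open>Exponents \<open>q \<ge> 2\<close> reduce to the Poisson kernel by bounding the surplus power of the denominator by
its extreme value; \<open>q = 2\<close> is the only case that has to be integrated.\<close>

lemma integral_circle_kernel_le:
  assumes v: "norm v < 1" and q: "2 \<le> q"
  shows "integral {0..2 * pi} (\<lambda>\<theta>. norm (1 - v * cis \<theta>) powr (-q)) \<le> 2 * pi * (1 - norm v) powr (1 - q)"
    and "(\<lambda>\<theta>. norm (1 - v * cis \<theta>) powr (-q)) integrable_on {0..2 * pi}"
proof -
  have low: "1 - norm v \<le> norm (1 - v * cis \<theta>)" for \<theta>
    using norm_triangle_ineq2[of 1 "v * cis \<theta>"] by (simp add: norm_mult)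
  have pos: "0 < norm (1 - v * cis \<theta>)" for \<theta> using low[of \<theta>] v by linarith
  show int: "(\<lambda>\<theta>. norm (1 - v * cis \<theta>) powr (-q)) integrable_on {0..2 * pi}"
    using pos by (intro integrable_continuous_real continuous_intros) auto
  have "integral {0..2 * pi} (\<lambda>\<theta>. norm (1 - v * cis \<theta>) powr (-q))
    \<le> integral {0..2 * pi} (\<lambda>\<theta>. (1 - norm v) powr (2 - q) * (1 / (norm (1 - v * cis \<theta>))\<^sup>2))"
  proof (rule integral_le[OF int])
    show "(\<lambda>\<theta>. (1 - norm v) powr (2 - q) * (1 / (norm (1 - v * cis \<theta>))\<^sup>2)) integrable_on {0..2 * pi}"
      using integral_circle_inverse_square[OF v] by (intro integrable_on_mult_right) blast
    fix \<theta>
    have "norm (1 - v * cis \<theta>) powr (-q) = norm (1 - v * cis \<theta>) powr (2 - q) * norm (1 - v * cis \<theta>) powr (-2)"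
      by (simp flip: powr_add)
    also have "\<dots> \<le> (1 - norm v) powr (2 - q) * norm (1 - v * cis \<theta>) powr (-2)"
      using low v q by (intro mult_right_mono powr_mono2') auto
    also have "norm (1 - v * cis \<theta>) powr (-2) = 1 / (norm (1 - v * cis \<theta>))\<^sup>2"
      using pos[of \<theta>] by (simp add: powr_minus powr_numeral field_simps)
    finally show "norm (1 - v * cis \<theta>) powr (-q) \<le> (1 - norm v) powr (2 - q) * (1 / (norm (1 - v * cis \<theta>))\<^sup>2)" .
  qed
  also have "\<dots> = (1 - norm v) powr (2 - q) * (2 * pi / (1 - (norm v)\<^sup>2))"
    using integral_unique[OF integral_circle_inverse_square[OF v]]
    by (subst integral_mult_right) simp
  also have "\<dots> \<le> (1 - norm v) powr (2 - q) * (2 * pi / (1 - norm v))"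
  proof -
    have "(norm v)\<^sup>2 \<le> norm v" using v by (simp add: power2_eq_square mult_left_le_one_le)
    then show ?thesis using v by (intro mult_left_mono divide_left_mono mult_pos_pos) auto
  qed
  also have "\<dots> = 2 * pi * (1 - norm v) powr (1 - q)"
    using v powr_diff[of "1 - norm v" "2 - q" 1] by simp
  finally show "integral {0..2 * pi} (\<lambda>\<theta>. norm (1 - v * cis \<theta>) powr (-q)) \<le> 2 * pi * (1 - norm v) powr (1 - q)" .
qed

lemma nn_integral_inverse_square_le:
  assumes "0 \<le> x" "x < 1"
  shows "(\<integral>\<^sup>+r\<in>{0..x}. ennreal ((1 - x) / (1 - r)\<^sup>2) \<partial>lborel) \<le> 1"
proof -
  have "((\<lambda>r. (1 - x) / (1 - r)\<^sup>2) has_integral (1 - x) / (1 - x) - (1 - x) / (1 - 0)) {0..x}"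
    using assms
    by (intro fundamental_theorem_of_calculus)
       (auto intro!: derivative_eq_intros simp: power2_eq_square simp flip: has_real_derivative_iff_has_vector_derivative)
  then have "(\<integral>\<^sup>+r\<in>{0..x}. ennreal ((1 - x) / (1 - r)\<^sup>2) \<partial>lborel) = ennreal ((1 - x) / (1 - x) - (1 - x) / (1 - 0))"
    by (intro nn_integral_has_integral_lebesgue') (use assms in auto)
  also have "\<dots> \<le> ennreal 1" using assms by (intro ennreal_leI) auto
  finally show ?thesis by simp
qed

lemma nn_integral_powr_near_1:
  fixes q :: real
  assumes "x < 1" "0 < q"
  shows "(\<integral>\<^sup>+r\<in>{x..1}. ennreal ((1 - x) powr (-q) * (1 - r) powr (q - 1)) \<partial>lborel) = ennreal (1 / q)"
proof -
  have "((\<lambda>r. (1 - x) powr (-q) * (1 - r) powr (q - 1)) has_integral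
      (- ((1 - x) powr (-q) * (1 - 1) powr q / q)) - (- ((1 - x) powr (-q) * (1 - x) powr q / q))) {x..1}"
    using assms
    by (intro fundamental_theorem_of_calculus_interior continuous_intros continuous_on_powr')
       (auto intro!: derivative_eq_intros simp: powr_diff simp flip: has_real_derivative_iff_has_vector_derivative)
  moreover have "(1 - x) powr (-q) * (1 - x) powr q = 1"
    using assms by (simp flip: powr_add)
  ultimately have "((\<lambda>r. (1 - x) powr (-q) * (1 - r) powr (q - 1)) has_integral 1 / q) {x..1}"
    using assms by simp
  then show ?thesis
    by (intro nn_integral_has_integral_lebesgue') auto
qed

section \<open>Norms of the test functions\<close>

text \<open>Up to constants, the left-hand side bounds the radial density of the \<open>p\<close>-th power of the norm of a test function
with peak at radius \<open>x\<close>. Inside the peak radius the power law with exponent \<open>t\<close> is absorbed by the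
kernel, whose exponent \<open>b \<ge> t * p + 1\<close> leaves one spare power of \<open>(1 - x) / (1 - r)\<close>. Outside it the kernel is
bounded and the decay with exponent \<open>s\<close> makes the density integrable up to the boundary. The integrals of both majorants
are bounded independently of \<open>x\<close>.\<close>

lemma normal_weight_kernel_pointwise:
  fixes p q :: real
  assumes p: "0 < p" and st: "0 < s" "s < t" and C: "0 < C"
    and \<phi>: "\<And>r. 0 \<le> r \<Longrightarrow> r < 1 \<Longrightarrow> \<phi> r > 0"
    and up: "\<And>x y. 0 \<le> x \<Longrightarrow> x \<le> y \<Longrightarrow> y < 1 \<Longrightarrow> \<phi> y \<le> C * \<phi> x * ((1 - y) / (1 - x)) powr s"
    and down: "\<And>x y. 0 \<le> x \<Longrightarrow> x \<le> y \<Longrightarrow> y < 1 \<Longrightarrow> \<phi> x \<le> C * \<phi> y * ((1 - x) / (1 - y)) powr t"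
    and b: "t * p + 1 \<le> b" and x: "0 \<le> x" "x < 1" and r: "0 \<le> r" "r < 1"
  shows "((1 - x) / (1 - x * r)) powr b * (\<phi> r / \<phi> x) powr p / (1 - r)
    \<le> C powr p * (if r \<le> x then (1 - x) / (1 - r)\<^sup>2 else (1 - x) powr (- (s * p)) * (1 - r) powr (s * p - 1))"
proof -
  have xr: "x * r \<le> x" "x * r \<le> r" using x r by (auto simp: mult_left_le mult_right_le_one_le mult_left_le_one_le)
  have b0: "b \<ge> 0" using b st p by (smt (verit) mult_pos_pos)
  show ?thesis
  proof (cases "r \<le> x")
    case True
    define y where "y = (1 - x) / (1 - r)"
    have y: "0 < y" "y \<le> 1" using True x r by (auto simp: y_def)
    have "\<phi> r / \<phi> x \<le> C * ((1 - r) / (1 - x)) powr t"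
      using down[of r x] True x r \<phi>[of x] by (simp add: field_simps)
    also have "((1 - r) / (1 - x)) powr t = y powr (- t)"
      using x r by (simp add: y_def powr_minus powr_divide)
    finally have "(\<phi> r / \<phi> x) powr p \<le> (C * y powr (-t)) powr p"
      using \<phi>[of x] \<phi>[of r] x r p by (intro powr_mono2) auto
    also have "\<dots> = C powr p * y powr (- (t * p))"
      using C by (simp add: powr_mult powr_powr)
    finally have 1: "(\<phi> r / \<phi> x) powr p \<le> C powr p * y powr (- (t * p))" .
    have 2: "((1 - x) / (1 - x * r)) powr b \<le> y powr b"
      unfolding y_def using x r xr b0 by (intro powr_mono2 frac_le) auto
    have "((1 - x) / (1 - x * r)) powr b * (\<phi> r / \<phi> x) powr p \<le> y powr b * (C powr p * y powr (- (t * p)))"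
      by (rule mult_mono[OF 2 1]) auto
    also have "\<dots> = C powr p * y powr (b - t * p)"
      by (simp add: powr_diff powr_minus field_simps)
    also have "\<dots> \<le> C powr p * y powr 1"
      using y b by (intro mult_left_mono powr_mono') auto
    finally have "((1 - x) / (1 - x * r)) powr b * (\<phi> r / \<phi> x) powr p / (1 - r) \<le> C powr p * y / (1 - r)"
      using r y by (intro divide_right_mono) auto
    then show ?thesis using True by (simp add: y_def power2_eq_square)
  next
    case False
    have "\<phi> r / \<phi> x \<le> C * ((1 - r) / (1 - x)) powr s"
      using up[of x r] False x r \<phi>[of x] by (simp add: field_simps)
    then have "(\<phi> r / \<phi> x) powr p \<le> (C * ((1 - r) / (1 - x)) powr s) powr p"
      using \<phi>[of x] \<phi>[of r] x r p by (intro powr_mono2) auto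
    also have "\<dots> = C powr p * ((1 - x) powr (- (s * p)) * (1 - r) powr (s * p))"
      using C x r by (simp add: powr_mult powr_powr powr_divide powr_minus field_simps)
    finally have 1: "(\<phi> r / \<phi> x) powr p \<le> C powr p * ((1 - x) powr (- (s * p)) * (1 - r) powr (s * p))" .
    have "((1 - x) / (1 - x * r)) powr b \<le> 1 powr b"
      using x r xr b0 by (intro powr_mono2) auto
    then have 2: "((1 - x) / (1 - x * r)) powr b \<le> 1" by simp
    have "((1 - x) / (1 - x * r)) powr b * (\<phi> r / \<phi> x) powr p
        \<le> 1 * (C powr p * ((1 - x) powr (- (s * p)) * (1 - r) powr (s * p)))"
      by (rule mult_mono[OF 2 1]) auto
    then have "((1 - x) / (1 - x * r)) powr b * (\<phi> r / \<phi> x) powr p / (1 - r)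
        \<le> 1 * (C powr p * ((1 - x) powr (- (s * p)) * (1 - r) powr (s * p))) / (1 - r)"
      using r by (intro divide_right_mono) auto
    then show ?thesis using False r by (simp add: powr_diff)
  qed
qed

text \<open>Functions dominated by the normalised kernel with peak at \<open>w\<close> have norms bounded uniformly in \<open>w\<close>. An
integer exponent \<open>N\<close> keeps the kernel free of branches of complex powers; it must be so large that
\<open>N * p - 1 \<ge> t * p + 1\<close>.\<close>

lemma Hpp_integral_test_function_le:
  assumes p: "0 < p" and nw: "normal_weight \<phi>"
  obtains N :: nat and D :: real where "0 < D"
    "\<And>f w A. f holomorphic_on unit_disk \<Longrightarrow> norm w < 1 \<Longrightarrow> 0 \<le> A \<Longrightarrow>
      (\<And>z. norm z < 1 \<Longrightarrow> norm (f z) \<le>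
         A * ((1 - (norm w)\<^sup>2) powr (real N - 1 / p) / \<phi> (norm w)) / norm (1 - cnj w * z) ^ N) \<Longrightarrow>
      Hpp_integral p \<phi> f \<le> ennreal (A powr p * D)"
proof -
  obtain s t C where st: "0 < s" "s < t" and C: "0 < C" and
    up: "\<And>x y. 0 \<le> x \<Longrightarrow> x \<le> y \<Longrightarrow> y < 1 \<Longrightarrow> \<phi> y \<le> C * \<phi> x * ((1 - y) / (1 - x)) powr s" and
    down: "\<And>x y. 0 \<le> x \<Longrightarrow> x \<le> y \<Longrightarrow> y < 1 \<Longrightarrow> \<phi> x \<le> C * \<phi> y * ((1 - x) / (1 - y)) powr t"
    using normal_weight_comparison[OF nw] by blast
  note pos = normal_weight_pos[OF nw]
  obtain N :: nat where N: "real N \<ge> t + 2 / p" using real_arch_simple by blast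
  define b where "b = real N * p - 1"
  have "real N * p \<ge> (t + 2 / p) * p" using N p by (intro mult_right_mono) auto
  then have b: "t * p + 1 \<le> b" using p by (simp add: b_def distrib_right)
  have tp: "t * p > 0" using st p by simp
  have b0: "b \<ge> 1" using b tp by simp
  define D where "D = 2 powr b * C powr p * (1 + 1 / (s * p))"
  show thesis
  proof
    show "0 < D" using C st p by (auto simp: D_def intro!: mult_pos_pos add_pos_pos)
    fix f w A
    assume f: "f holomorphic_on unit_disk" and w: "norm (w::complex) < 1" and A: "0 \<le> (A::real)"
      and le: "\<And>z. norm z < 1 \<Longrightarrow> norm (f z) \<le>
         A * ((1 - (norm w)\<^sup>2) powr (real N - 1 / p) / \<phi> (norm w)) / norm (1 - cnj w * z) ^ N"
    define x where "x = norm w"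
    have x: "0 \<le> x" "x < 1" using w by (auto simp: x_def)
    have px: "\<phi> x > 0" using pos x by simp
    define G where "G = (\<lambda>r. if r \<le> x then (1 - x) / (1 - r)\<^sup>2 else (1 - x) powr (- (s * p)) * (1 - r) powr (s * p - 1))"
    have mean: "integral_mean p f r powr p \<le> A powr p * 2 powr b * ((1 - x) / (1 - x * r)) powr b / \<phi> x powr p"
      if r: "0 \<le> r" "r < 1" for r
    proof -
      define c where "c = A * ((1 - x\<^sup>2) powr (real N - 1 / p) / \<phi> x)"
      define v where "v = cnj w * of_real r"
      have nv: "norm v = x * r" using r by (simp add: v_def x_def norm_mult)
      have "x * r \<le> x" using x r by (simp add: mult_left_le)
      then have xr: "x * r < 1" using x by simp
      have x2: "x\<^sup>2 \<le> 1" using x by (simp add: power_le_one)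
      have c0: "c \<ge> 0" using A px by (simp add: c_def)
      have ptw: "norm (f (of_real r * cis \<theta>)) powr p \<le> c powr p * norm (1 - v * cis \<theta>) powr (- (b + 1))" for \<theta>
      proof -
        have "norm (f (of_real r * cis \<theta>)) \<le> c / norm (1 - cnj w * (of_real r * cis \<theta>)) ^ N"
          unfolding c_def x_def by (rule le) (use r in \<open>simp add: norm_mult\<close>)
        also have "cnj w * (of_real r * cis \<theta>) = v * cis \<theta>" by (simp add: v_def)
        finally have "norm (f (of_real r * cis \<theta>)) powr p \<le> (c / norm (1 - v * cis \<theta>) ^ N) powr p"
          using p by (intro powr_mono2) auto
        also have "\<dots> = c powr p / norm (1 - v * cis \<theta>) powr (real N * p)"
        proof -
          have "1 - norm v \<le> norm (1 - v * cis \<theta>)"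
            using norm_triangle_ineq2[of 1 "v * cis \<theta>"] by (simp add: norm_mult)
          then have "norm (1 - v * cis \<theta>) > 0" using nv xr by linarith
          then show ?thesis using c0
            by (subst powr_divide) (auto simp: powr_powr simp flip: powr_realpow)
        qed
        also have "\<dots> = c powr p * norm (1 - v * cis \<theta>) powr (- (b + 1))"
          unfolding b_def powr_minus by (simp add: field_simps)
        finally show ?thesis .
      qed
      have v1: "norm v < 1" using nv xr by simp
      have q2: "2 \<le> b + 1" using b0 by simp
      have "integral_mean p f r powr p = 1 / (2 * pi) * integral {0..2 * pi} (\<lambda>\<theta>. norm (f (of_real r * cis \<theta>)) powr p)"
        by (rule integral_mean_powr[OF f r p])
      also have "\<dots> \<le> 1 / (2 * pi) * integral {0..2 * pi} (\<lambda>\<theta>. c powr p * norm (1 - v * cis \<theta>) powr (- (b + 1)))"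
      proof (intro mult_left_mono integral_le ptw)
        show "(\<lambda>\<theta>. norm (f (of_real r * cis \<theta>)) powr p) integrable_on {0..2 * pi}"
          by (intro integrable_continuous_real continuous_on_circle_powr f r p)
        show "(\<lambda>\<theta>. c powr p * norm (1 - v * cis \<theta>) powr (- (b + 1))) integrable_on {0..2 * pi}"
          by (intro integrable_on_mult_right integral_circle_kernel_le(2)[OF v1 q2])
      qed auto
      also have "\<dots> = 1 / (2 * pi) * (c powr p * integral {0..2 * pi} (\<lambda>\<theta>. norm (1 - v * cis \<theta>) powr (- (b + 1))))"
        by simp
      also have "\<dots> \<le> 1 / (2 * pi) * (c powr p * (2 * pi * (1 - norm v) powr (1 - (b + 1))))"
        using integral_circle_kernel_le(1)[OF v1 q2] by (intro mult_left_mono) auto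
      also have "\<dots> = c powr p * (1 - x * r) powr (- b)" by (simp add: nv)
      also have "c powr p = A powr p * (1 - x\<^sup>2) powr b / \<phi> x powr p"
      proof -
        have "(real N - 1 / p) * p = b" using p by (simp add: b_def field_simps)
        then show ?thesis using A x2 px unfolding c_def
          by (simp add: powr_mult powr_divide powr_powr)
      qed
      also have "A powr p * (1 - x\<^sup>2) powr b / \<phi> x powr p * (1 - x * r) powr (- b)
          \<le> A powr p * (2 * (1 - x)) powr b / \<phi> x powr p * (1 - x * r) powr (- b)"
      proof -
        have "1 - x\<^sup>2 = (1 + x) * (1 - x)" by (simp add: power2_eq_square algebra_simps)
        also have "\<dots> \<le> 2 * (1 - x)" using x by (intro mult_right_mono) auto
        finally have "(1 - x\<^sup>2) powr b \<le> (2 * (1 - x)) powr b" using x2 b0 by (intro powr_mono2) auto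
        then show ?thesis using A by (intro mult_right_mono divide_right_mono mult_left_mono) auto
      qed
      also have "\<dots> = A powr p * 2 powr b * ((1 - x) / (1 - x * r)) powr b / \<phi> x powr p"
      proof -
        have "(2 * (1 - x)) powr b = 2 powr b * (1 - x) powr b" using x by (subst powr_mult) auto
        moreover have "((1 - x) / (1 - x * r)) powr b = (1 - x) powr b / (1 - x * r) powr b"
          using x xr by (subst powr_divide) auto
        ultimately show ?thesis by (simp add: powr_minus field_simps)
      qed
      finally show ?thesis .
    qed
    have ptw: "integral_mean p f r powr p * (\<phi> r powr p / (1 - r)) * r \<le> A powr p * 2 powr b * C powr p * G r"
      if r: "0 \<le> r" "r < 1" for r
    proof -
      have pr: "\<phi> r > 0" using pos r by simp
      have "integral_mean p f r powr p * (\<phi> r powr p / (1 - r)) * r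
          \<le> integral_mean p f r powr p * (\<phi> r powr p / (1 - r)) * 1"
        using r by (intro mult_left_mono mult_nonneg_nonneg divide_nonneg_nonneg) auto
      also have "\<dots> \<le> A powr p * 2 powr b * ((1 - x) / (1 - x * r)) powr b / \<phi> x powr p * (\<phi> r powr p / (1 - r)) * 1"
        using mean[OF r] r by (intro mult_right_mono) auto
      also have "\<dots> = A powr p * 2 powr b * (((1 - x) / (1 - x * r)) powr b * (\<phi> r / \<phi> x) powr p / (1 - r))"
        using pr px by (simp add: powr_divide)
      also have "\<dots> \<le> A powr p * 2 powr b * (C powr p * G r)"
        unfolding G_def using A
        by (intro mult_left_mono normal_weight_kernel_pointwise[OF p st C pos up down b x r]) auto
      finally show ?thesis by simp
    qed
    define E where "E = A powr p * 2 powr b * C powr p"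
    have E: "E \<ge> 0" by (simp add: E_def)
    define G1 where "G1 = (\<lambda>r. ennreal ((1 - x) / (1 - r)\<^sup>2) * indicator {0..x} r)"
    define G2 where "G2 = (\<lambda>r. ennreal ((1 - x) powr (- (s * p)) * (1 - r) powr (s * p - 1)) * indicator {x..1} r)"
    have meas [measurable]: "G1 \<in> borel_measurable lborel" "G2 \<in> borel_measurable lborel"
      unfolding G1_def G2_def by measurable
    have "Hpp_integral p \<phi> f \<le> (\<integral>\<^sup>+r. ennreal E * (G1 r + G2 r) \<partial>lborel)"
      unfolding Hpp_integral_def
    proof (rule nn_integral_mono)
      fix r
      show "ennreal (integral_mean p f r powr p * (\<phi> r powr p / (1 - r)) * r) * indicator {0..<1} r \<le> ennreal E * (G1 r + G2 r)"
      proof (cases "r \<in> {0..<1}")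
        case True
        then have r: "0 \<le> r" "r < 1" by auto
        have "ennreal (integral_mean p f r powr p * (\<phi> r powr p / (1 - r)) * r) \<le> ennreal (E * G r)"
          using ptw[OF r] by (intro ennreal_leI) (simp add: E_def)
        also have "\<dots> = ennreal E * ennreal (G r)" using E by (simp add: ennreal_mult')
        also have "\<dots> \<le> ennreal E * (G1 r + G2 r)"
          using r by (intro mult_left_mono) (auto simp: G_def G1_def G2_def)
        finally show ?thesis using True by simp
      qed auto
    qed
    also have "\<dots> = ennreal E * ((\<integral>\<^sup>+r. G1 r \<partial>lborel) + (\<integral>\<^sup>+r. G2 r \<partial>lborel))"
      by (simp add: nn_integral_cmult nn_integral_add)
    also have "\<dots> \<le> ennreal E * (1 + ennreal (1 / (s * p)))"
      unfolding G1_def G2_def using nn_integral_inverse_square_le[OF x] nn_integral_powr_near_1[of x "s * p"] x st p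
      by (intro mult_left_mono add_mono) auto
    also have "\<dots> = ennreal (E * (1 + 1 / (s * p)))"
      using E st p by (simp add: ennreal_mult' flip: ennreal_plus ennreal_1)
    also have "E * (1 + 1 / (s * p)) = A powr p * D" by (simp add: E_def D_def)
    finally show "Hpp_integral p \<phi> f \<le> ennreal (A powr p * D)" .
  qed
qed

section \<open>Weighted composition operators\<close>

text \<open>The quotient of the two sides is the modulus of a disk automorphism at \<open>z\<close>.\<close>

lemma norm_diff_le_norm_one_minus_cnj_mult:
  assumes "norm w < 1" "norm z < 1"
  shows "norm (z - w) \<le> norm (1 - cnj w * z)"
proof -
  have "norm (Moebius_function 0 w z) < 1"
    by (rule Moebius_function_norm_lt_1[OF assms])
  then have "norm (z - w) / norm (1 - cnj w * z) < 1"
    by (simp add: Moebius_function_def norm_divide norm_mult)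
  moreover have "norm (1 - cnj w * z) > 0"
    using one_minus_mult_neq_0[of "cnj w" z] assms by simp
  ultimately show ?thesis by (simp add: field_simps)
qed

lemma analytic_self_map_norm_less: "analytic_self_map \<psi> \<Longrightarrow> norm z < 1 \<Longrightarrow> norm (\<psi> z) < 1"
  by (auto simp: analytic_self_map_def image_subset_iff)

lemma deriv_weighted_comp_op:
  assumes \<psi>: "analytic_self_map \<psi>" and u: "u holomorphic_on unit_disk"
    and f: "f holomorphic_on unit_disk" and z: "norm z < 1"
  shows "deriv (weighted_comp_op u \<psi> f) z = deriv u z * f (\<psi> z) + u z * deriv \<psi> z * deriv f (\<psi> z)"
proof -
  have h: "\<psi> holomorphic_on unit_disk" and m: "\<psi> z \<in> unit_disk"
    using \<psi> z analytic_self_map_norm_less[OF \<psi> z] by (auto simp: analytic_self_map_def)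
  have "(\<psi> has_field_derivative deriv \<psi> z) (at z)" "(u has_field_derivative deriv u z) (at z)"
    "(f has_field_derivative deriv f (\<psi> z)) (at (\<psi> z))"
    using z m by (auto intro!: holomorphic_derivI[OF h] holomorphic_derivI[OF u] holomorphic_derivI[OF f])
  then have "((\<lambda>z. u z * f (\<psi> z)) has_field_derivative
      deriv u z * f (\<psi> z) + deriv f (\<psi> z) * deriv \<psi> z * u z) (at z)"
    by (intro DERIV_mult DERIV_chain2)
  then show ?thesis unfolding weighted_comp_op_def
    by (subst DERIV_imp_deriv) (auto simp: mult_ac)
qed

lemma holomorphic_weighted_comp_op:
  assumes "analytic_self_map \<psi>" "u holomorphic_on unit_disk" "f holomorphic_on unit_disk"
  shows "weighted_comp_op u \<psi> f holomorphic_on unit_disk"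
proof -
  have "(f \<circ> \<psi>) holomorphic_on unit_disk"
    using assms by (intro holomorphic_on_compose_gen[of _ _ _ unit_disk]) (auto simp: analytic_self_map_def)
  then show ?thesis
    unfolding weighted_comp_op_def using assms(2) by (auto intro!: holomorphic_intros simp: o_def)
qed

text \<open>In \<open>(u * (f \<circ> \<psi>))' = u' * (f \<circ> \<psi>) + u * \<psi>' * (f' \<circ> \<psi>)\<close> the point estimates for \<open>f\<close> and \<open>f'\<close> at \<open>\<psi> z\<close>
produce exactly the two denominators of the conditions.\<close>

lemma weighted_comp_op_bounded_if:
  fixes \<psi> u :: "complex \<Rightarrow> complex"
  assumes \<psi>: "analytic_self_map \<psi>" and u: "u holomorphic_on unit_disk"
    and p: "0 < p" and \<phi>: "normal_weight \<phi>"
    and b1: "bdd_above ((\<lambda>z. (1 - (norm z)\<^sup>2) * norm (deriv u z) /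
             (\<phi> (norm (\<psi> z)) * (1 - (norm (\<psi> z))\<^sup>2) powr (1 / p))) ` unit_disk)"
    and b2: "bdd_above ((\<lambda>z. (1 - (norm z)\<^sup>2) * norm (u z * deriv \<psi> z) /
             (\<phi> (norm (\<psi> z)) * (1 - (norm (\<psi> z))\<^sup>2) powr (1 + 1 / p))) ` unit_disk)"
  shows "bounded_operator (Hpp_space p \<phi>) (Hpp_norm p \<phi>) Bloch_space Bloch_norm (weighted_comp_op u \<psi>)"
proof -
  obtain K1 where K1: "\<And>z. z \<in> unit_disk \<Longrightarrow> (1 - (norm z)\<^sup>2) * norm (deriv u z) /
             (\<phi> (norm (\<psi> z)) * (1 - (norm (\<psi> z))\<^sup>2) powr (1 / p)) \<le> K1"
    using b1 unfolding bdd_above_def by blast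
  obtain K2 where K2: "\<And>z. z \<in> unit_disk \<Longrightarrow> (1 - (norm z)\<^sup>2) * norm (u z * deriv \<psi> z) /
             (\<phi> (norm (\<psi> z)) * (1 - (norm (\<psi> z))\<^sup>2) powr (1 + 1 / p)) \<le> K2"
    using b2 unfolding bdd_above_def by blast
  obtain C where C: "0 < C" and
    e1: "\<And>f w. f \<in> Hpp_space p \<phi> \<Longrightarrow> norm w < 1 \<Longrightarrow>
      norm (f w) \<le> C * Hpp_norm p \<phi> f / (\<phi> (norm w) * (1 - (norm w)\<^sup>2) powr (1 / p))" and
    e2: "\<And>f w. f \<in> Hpp_space p \<phi> \<Longrightarrow> norm w < 1 \<Longrightarrow>
      norm (deriv f w) \<le> C * Hpp_norm p \<phi> f / (\<phi> (norm w) * (1 - (norm w)\<^sup>2) powr (1 + 1 / p))"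
    using Hpp_point_estimates[OF p \<phi>] by blast
  define T where "T = weighted_comp_op u \<psi>"
  have N0: "0 \<le> Hpp_norm p \<phi> f" for f by (simp add: Hpp_norm_def)
  have der: "(1 - (norm z)\<^sup>2) * norm (deriv (T f) z) \<le> (K1 + K2) * (C * Hpp_norm p \<phi> f)"
    if f: "f \<in> Hpp_space p \<phi>" and z: "z \<in> unit_disk" for f z
  proof -
    have hf: "f holomorphic_on unit_disk" using f by (auto simp: Hpp_space_def)
    have z1: "norm z < 1" and y1: "norm (\<psi> z) < 1" using z analytic_self_map_norm_less[OF \<psi>, of z] by auto
    have zz: "0 \<le> 1 - (norm z)\<^sup>2" using z1 by (simp add: power_le_one)
    define n where "n = C * Hpp_norm p \<phi> f"
    have n: "0 \<le> n" using C N0 by (simp add: n_def)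
    define W1 where "W1 = \<phi> (norm (\<psi> z)) * (1 - (norm (\<psi> z))\<^sup>2) powr (1 / p)"
    define W2 where "W2 = \<phi> (norm (\<psi> z)) * (1 - (norm (\<psi> z))\<^sup>2) powr (1 + 1 / p)"
    have "(1 - (norm z)\<^sup>2) * norm (deriv (T f) z)
        \<le> (1 - (norm z)\<^sup>2) * (norm (deriv u z) * norm (f (\<psi> z)) + norm (u z * deriv \<psi> z) * norm (deriv f (\<psi> z)))"
      unfolding T_def deriv_weighted_comp_op[OF \<psi> u hf z1] using zz
      by (intro mult_left_mono order_trans[OF norm_triangle_ineq]) (auto simp: norm_mult)
    also have "\<dots> \<le> (1 - (norm z)\<^sup>2) * (norm (deriv u z) * (n / W1) + norm (u z * deriv \<psi> z) * (n / W2))"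
      using zz e1[OF f y1] e2[OF f y1] unfolding n_def W1_def W2_def
      by (intro mult_left_mono add_mono) auto
    also have "\<dots> = ((1 - (norm z)\<^sup>2) * norm (deriv u z) / W1) * n + ((1 - (norm z)\<^sup>2) * norm (u z * deriv \<psi> z) / W2) * n"
      by (simp add: algebra_simps)
    also have "\<dots> \<le> K1 * n + K2 * n"
      using K1[OF z] K2[OF z] n unfolding W1_def W2_def by (intro add_mono mult_right_mono)
    finally show ?thesis by (simp add: n_def algebra_simps)
  qed
  have "T ` Hpp_space p \<phi> \<subseteq> Bloch_space"
  proof
    fix g assume "g \<in> T ` Hpp_space p \<phi>"
    then obtain f where f: "f \<in> Hpp_space p \<phi>" and g: "g = T f" by blast
    then have "f holomorphic_on unit_disk" by (auto simp: Hpp_space_def)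
    with holomorphic_weighted_comp_op[OF \<psi> u] have "g holomorphic_on unit_disk" by (auto simp: g T_def)
    moreover have "bdd_above ((\<lambda>z. (1 - (norm z)\<^sup>2) * norm (deriv g z)) ` unit_disk)"
      by (rule bdd_aboveI2) (use der[OF f] in \<open>auto simp: g\<close>)
    ultimately show "g \<in> Bloch_space" by (simp add: Bloch_space_def)
  qed
  moreover have "bdd_above (Bloch_norm ` T ` S)"
    if S: "S \<subseteq> Hpp_space p \<phi>" and bS: "bdd_above (Hpp_norm p \<phi> ` S)" for S
  proof -
    obtain M where M: "\<And>f. f \<in> S \<Longrightarrow> Hpp_norm p \<phi> f \<le> M"
      using bS unfolding bdd_above_def by blast
    define W where "W = \<phi> (norm (\<psi> 0)) * (1 - (norm (\<psi> 0))\<^sup>2) powr (1 / p)"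
    define L where "L = norm (u 0) * (C / W) + (\<bar>K1\<bar> + \<bar>K2\<bar>) * C"
    have y0: "norm (\<psi> 0) < 1" using analytic_self_map_norm_less[OF \<psi>, of 0] by simp
    have W: "W \<ge> 0" using normal_weight_pos[OF \<phi> _ y0] by (simp add: W_def)
    have L: "L \<ge> 0" using C W by (auto simp: L_def intro!: add_nonneg_nonneg mult_nonneg_nonneg)
    have "Bloch_norm (T f) \<le> L * M" if fS: "f \<in> S" for f
    proof -
      have f: "f \<in> Hpp_space p \<phi>" using S fS by blast
      have "norm (T f 0) \<le> norm (u 0) * (C * Hpp_norm p \<phi> f / W)"
        unfolding T_def weighted_comp_op_def norm_mult W_def
        by (intro mult_left_mono e1[OF f y0]) auto
      moreover have "(SUP z\<in>unit_disk. (1 - (norm z)\<^sup>2) * norm (deriv (T f) z)) \<le> (K1 + K2) * (C * Hpp_norm p \<phi> f)"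
        by (rule cSUP_least) (use der[OF f] in auto)
      moreover have "(K1 + K2) * (C * Hpp_norm p \<phi> f) \<le> (\<bar>K1\<bar> + \<bar>K2\<bar>) * (C * Hpp_norm p \<phi> f)"
        using C N0 by (intro mult_right_mono) auto
      ultimately have "Bloch_norm (T f) \<le> L * Hpp_norm p \<phi> f"
        unfolding Bloch_norm_def L_def by (simp add: algebra_simps)
      also have "\<dots> \<le> L * M" using M[OF fS] L by (intro mult_left_mono)
      finally show ?thesis .
    qed
    then show ?thesis by (auto intro!: bdd_aboveI2)
  qed
  ultimately show ?thesis unfolding bounded_operator_def T_def by blast
qed

text \<open>The function \<open>k\<close> isolates the value at \<open>w\<close> and \<open>h\<close> isolates the derivative at \<open>w\<close>. With \<open>E z = 1 - cnj w * z\<close>,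
so that \<open>E w = 1 - (norm w)\<^sup>2\<close>, the starting point is the kernel \<open>c / E ^ N\<close>. Multiplying it by
\<open>(z - w) / E z\<close>, a disk automorphism, gives \<open>h\<close>: it vanishes at \<open>w\<close> and is still
dominated by the kernel. Subtracting the multiple \<open>N * cnj w\<close> of \<open>h\<close> from the kernel removes the derivative at \<open>w\<close>
without touching the value, which gives \<open>k\<close>. In this form \<open>deriv h w\<close> carries no factor \<open>cnj w\<close>, so points \<open>w\<close> near the
origin need no special care.\<close>

lemma Hpp_test_functions:
  assumes p: "0 < p" and nw: "normal_weight \<phi>"
  obtains M where
    "\<And>w. norm w < 1 \<Longrightarrow> \<exists>k h. k \<in> Hpp_space p \<phi> \<and> h \<in> Hpp_space p \<phi> \<and>
       Hpp_norm p \<phi> k \<le> M \<and> Hpp_norm p \<phi> h \<le> M \<and>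
       k w = of_real (1 / (\<phi> (norm w) * (1 - (norm w)\<^sup>2) powr (1 / p))) \<and> deriv k w = 0 \<and>
       h w = 0 \<and> deriv h w = of_real (1 / (\<phi> (norm w) * (1 - (norm w)\<^sup>2) powr (1 + 1 / p)))"
proof -
  obtain N :: nat and D where D: "0 < D" and test:
    "\<And>f w A. f holomorphic_on unit_disk \<Longrightarrow> norm w < 1 \<Longrightarrow> 0 \<le> A \<Longrightarrow>
      (\<And>z. norm z < 1 \<Longrightarrow> norm (f z) \<le>
         A * ((1 - (norm w)\<^sup>2) powr (real N - 1 / p) / \<phi> (norm w)) / norm (1 - cnj w * z) ^ N) \<Longrightarrow>
      Hpp_integral p \<phi> f \<le> ennreal (A powr p * D)"
    using Hpp_integral_test_function_le[OF p nw] by metis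
  define A where "A = 1 + real N"
  have mem: "f \<in> Hpp_space p \<phi> \<and> Hpp_norm p \<phi> f \<le> (A powr p * D) powr (1 / p)"
    if f: "f holomorphic_on unit_disk" and w: "norm w < 1"
      and le: "\<And>z. norm z < 1 \<Longrightarrow> norm (f z) \<le>
         A * ((1 - (norm w)\<^sup>2) powr (real N - 1 / p) / \<phi> (norm w)) / norm (1 - cnj w * z) ^ N"
    for f and w :: complex
  proof -
    have b: "Hpp_integral p \<phi> f \<le> ennreal (A powr p * D)"
      by (rule test[OF f w _ le]) (auto simp: A_def)
    then have "f \<in> Hpp_space p \<phi>" using f by (auto simp: Hpp_space_def intro: le_less_trans)
    moreover have "enn2real (Hpp_integral p \<phi> f) \<le> A powr p * D"
      using b D by (intro enn2real_leI) auto
    ultimately show ?thesis using p unfolding Hpp_norm_def by (auto intro!: powr_mono2)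
  qed
  show thesis
  proof
    fix w :: complex assume w: "norm w < 1"
    define x where "x = norm w"
    have x: "0 \<le> x" "x < 1" using w by (auto simp: x_def)
    have px: "\<phi> x > 0" using normal_weight_pos[OF nw x] .
    have x2: "x\<^sup>2 < 1" using x by (simp add: abs_square_less_1)
    define c where "c = (1 - x\<^sup>2) powr (real N - 1 / p) / \<phi> x"
    have c: "c \<ge> 0" using px by (simp add: c_def)
    define E where "E = (\<lambda>z. 1 - cnj w * z)"
    have Ew: "E w = of_real (1 - x\<^sup>2)"
      by (simp add: E_def x_def complex_norm_square mult.commute del: of_real_power)
    have E0: "E z \<noteq> 0" if "norm z < 1" for z
      using one_minus_mult_neq_0[of "cnj w" z] w that by (simp add: E_def)
    define h where "h = (\<lambda>z. (z - w) * of_real c / E z ^ Suc N)"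
    define k where "k = (\<lambda>z. of_real c / E z ^ N - of_nat N * cnj w * h z)"
    have hh: "h holomorphic_on unit_disk" unfolding h_def E_def
      by (intro holomorphic_intros) (use E0 in \<open>auto simp: E_def\<close>)
    have hk: "k holomorphic_on unit_disk" unfolding k_def E_def
      by (intro holomorphic_intros hh) (use E0 in \<open>auto simp: E_def\<close>)
    have hle: "norm (h z) \<le> c / norm (E z) ^ N" if z: "norm z < 1" for z
    proof -
      have "norm (h z) = norm (z - w) * (c / norm (E z) ^ Suc N)"
        using c by (simp add: h_def norm_mult norm_divide norm_power)
      also have "\<dots> \<le> norm (E z) * (c / norm (E z) ^ Suc N)"
        using norm_diff_le_norm_one_minus_cnj_mult[OF w z] c unfolding E_def
        by (intro mult_right_mono) auto
      also have "\<dots> = c / norm (E z) ^ N" using E0[OF z] by simp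
      finally show ?thesis .
    qed
    have kle: "norm (k z) \<le> A * c / norm (E z) ^ N" if z: "norm z < 1" for z
    proof -
      have "norm (k z) \<le> norm (of_real c / E z ^ N) + norm (of_nat N * cnj w * h z)"
        unfolding k_def by (rule norm_triangle_ineq4)
      also have "\<dots> = c / norm (E z) ^ N + real N * norm w * norm (h z)"
        using c by (simp add: norm_mult norm_divide norm_power)
      also have "\<dots> \<le> c / norm (E z) ^ N + real N * 1 * (c / norm (E z) ^ N)"
        using w hle[OF z] by (intro add_left_mono mult_mono) auto
      also have "\<dots> = A * c / norm (E z) ^ N" by (simp add: A_def add_divide_distrib distrib_right)
      finally show ?thesis .
    qed
    have hle': "norm (h z) \<le> A * c / norm (E z) ^ N" if "norm z < 1" for z
    proof -
      have "c / norm (E z) ^ N \<le> A * c / norm (E z) ^ N"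
        using c by (intro divide_right_mono) (auto simp: A_def mult_le_cancel_right1)
      with hle[OF that] show ?thesis by linarith
    qed
    have hm: "h \<in> Hpp_space p \<phi> \<and> Hpp_norm p \<phi> h \<le> (A powr p * D) powr (1 / p)"
      by (rule mem[OF hh w]) (use hle' in \<open>simp add: E_def c_def x_def\<close>)
    have km: "k \<in> Hpp_space p \<phi> \<and> Hpp_norm p \<phi> k \<le> (A powr p * D) powr (1 / p)"
      by (rule mem[OF hk w]) (use kle in \<open>simp add: E_def c_def x_def\<close>)
    have hw: "h w = 0" by (simp add: h_def)
    have dh: "(h has_field_derivative of_real c / E w ^ Suc N) (at w)"
    proof -
      have "((\<lambda>z. (z - w) * (of_real c / E z ^ Suc N)) has_field_derivative
        1 * (of_real c / E w ^ Suc N) + deriv (\<lambda>z. of_real c / E z ^ Suc N) w * (w - w)) (at w)"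
      proof (rule DERIV_mult)
        have "(\<lambda>z. of_real c / E z ^ Suc N) holomorphic_on unit_disk"
          unfolding E_def by (intro holomorphic_intros) (use E0 in \<open>auto simp: E_def\<close>)
        then show "((\<lambda>z. of_real c / E z ^ Suc N) has_field_derivative deriv (\<lambda>z. of_real c / E z ^ Suc N) w) (at w)"
          by (rule holomorphic_derivI) (use w in auto)
      qed (auto intro!: derivative_eq_intros)
      then show ?thesis by (simp add: h_def)
    qed
    have dk: "(k has_field_derivative 0) (at w)"
    proof -
      have dE: "(E has_field_derivative - cnj w) (at w)"
        unfolding E_def by (auto intro!: derivative_eq_intros)
      have "((\<lambda>z. of_real c / E z ^ N) has_field_derivative of_nat N * cnj w * (of_real c / E w ^ Suc N)) (at w)"
      proof -
        have "((\<lambda>z. of_real c / E z ^ N) has_field_derivative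
            (0 * E w ^ N - of_real c * (of_nat N * (- cnj w * E w ^ (N - Suc 0)))) / (E w ^ N * E w ^ N)) (at w)"
          using E0[OF w] by (intro DERIV_divide DERIV_const DERIV_power dE) auto
        moreover have "(0 * E w ^ N - of_real c * (of_nat N * (- cnj w * E w ^ (N - Suc 0)))) / (E w ^ N * E w ^ N)
            = of_nat N * cnj w * (of_real c / E w ^ Suc N)"
          using E0[OF w] by (cases N) (simp_all add: field_simps)
        ultimately show ?thesis by metis
      qed
      then have "(k has_field_derivative of_nat N * cnj w * (of_real c / E w ^ Suc N)
          - of_nat N * cnj w * (of_real c / E w ^ Suc N)) (at w)"
        unfolding k_def by (intro DERIV_diff DERIV_cmult dh)
      then show ?thesis by simp
    qed
    have pw: "c / (1 - x\<^sup>2) ^ n = 1 / (\<phi> x * (1 - x\<^sup>2) powr (real n - real N + 1 / p))" for n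
    proof -
      have "(1 - x\<^sup>2) ^ n = (1 - x\<^sup>2) powr real n" using x2 by (simp add: powr_realpow)
      then show ?thesis using x2 px unfolding c_def
        by (simp add: powr_diff powr_add field_simps)
    qed
    have kw: "k w = of_real (1 / (\<phi> x * (1 - x\<^sup>2) powr (1 / p)))"
    proof -
      have "k w = of_real (c / (1 - x\<^sup>2) ^ N)" by (simp add: k_def hw Ew)
      then show ?thesis using pw[of N] by simp
    qed
    have "of_real c / E w ^ Suc N = of_real (c / (1 - x\<^sup>2) ^ Suc N)"
      unfolding Ew of_real_divide of_real_power ..
    then have dhw: "deriv h w = of_real (1 / (\<phi> x * (1 - x\<^sup>2) powr (1 + 1 / p)))"
      unfolding DERIV_imp_deriv[OF dh] pw[of "Suc N"] by simp
    show "\<exists>k h. k \<in> Hpp_space p \<phi> \<and> h \<in> Hpp_space p \<phi> \<and>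
       Hpp_norm p \<phi> k \<le> (A powr p * D) powr (1 / p) \<and> Hpp_norm p \<phi> h \<le> (A powr p * D) powr (1 / p) \<and>
       k w = of_real (1 / (\<phi> (norm w) * (1 - (norm w)\<^sup>2) powr (1 / p))) \<and> deriv k w = 0 \<and>
       h w = 0 \<and> deriv h w = of_real (1 / (\<phi> (norm w) * (1 - (norm w)\<^sup>2) powr (1 + 1 / p)))"
      using hm km kw dhw hw DERIV_imp_deriv[OF dk] unfolding x_def by blast
  qed
qed

text \<open>Feeding the test functions with peak at \<open>\<psi> z\<close> to the operator and reading off the derivative of the image
at \<open>z\<close>, the function \<open>k\<close> leaves only the term with \<open>u'\<close> and \<open>h\<close> only the term with \<open>u * \<psi>'\<close>.\<close>

lemma weighted_comp_op_bounded_only_if: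
  fixes \<psi> u :: "complex \<Rightarrow> complex"
  assumes \<psi>: "analytic_self_map \<psi>" and u: "u holomorphic_on unit_disk"
    and p: "0 < p" and \<phi>: "normal_weight \<phi>"
    and bop: "bounded_operator (Hpp_space p \<phi>) (Hpp_norm p \<phi>) Bloch_space Bloch_norm (weighted_comp_op u \<psi>)"
  shows "bdd_above ((\<lambda>z. (1 - (norm z)\<^sup>2) * norm (deriv u z) /
             (\<phi> (norm (\<psi> z)) * (1 - (norm (\<psi> z))\<^sup>2) powr (1 / p))) ` unit_disk)"
    and "bdd_above ((\<lambda>z. (1 - (norm z)\<^sup>2) * norm (u z * deriv \<psi> z) /
             (\<phi> (norm (\<psi> z)) * (1 - (norm (\<psi> z))\<^sup>2) powr (1 + 1 / p))) ` unit_disk)"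
proof -
  define T where "T = weighted_comp_op u \<psi>"
  obtain M where M: "\<And>w. norm w < 1 \<Longrightarrow> \<exists>k h. k \<in> Hpp_space p \<phi> \<and> h \<in> Hpp_space p \<phi> \<and>
       Hpp_norm p \<phi> k \<le> M \<and> Hpp_norm p \<phi> h \<le> M \<and>
       k w = of_real (1 / (\<phi> (norm w) * (1 - (norm w)\<^sup>2) powr (1 / p))) \<and> deriv k w = 0 \<and>
       h w = 0 \<and> deriv h w = of_real (1 / (\<phi> (norm w) * (1 - (norm w)\<^sup>2) powr (1 + 1 / p)))"
    using Hpp_test_functions[OF p \<phi>] by metis
  define S where "S = {f \<in> Hpp_space p \<phi>. Hpp_norm p \<phi> f \<le> M}"
  have "bdd_above (Hpp_norm p \<phi> ` S)" by (auto simp: S_def intro!: bdd_aboveI2)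
  moreover have "S \<subseteq> Hpp_space p \<phi>" by (auto simp: S_def)
  ultimately have bT: "bdd_above (Bloch_norm ` T ` S)" and TS: "T ` S \<subseteq> Bloch_space"
    using bop unfolding bounded_operator_def T_def by auto
  from bT obtain B where B: "\<And>f. f \<in> S \<Longrightarrow> Bloch_norm (T f) \<le> B"
    unfolding bdd_above_def by blast
  have main: "(1 - (norm z)\<^sup>2) * norm (deriv u z * f (\<psi> z) + u z * deriv \<psi> z * deriv f (\<psi> z)) \<le> B"
    if f: "f \<in> S" and z: "z \<in> unit_disk" for f z
  proof -
    have hf: "f holomorphic_on unit_disk" using f by (auto simp: S_def Hpp_space_def)
    have "bdd_above ((\<lambda>z. (1 - (norm z)\<^sup>2) * norm (deriv (T f) z)) ` unit_disk)"
      using TS f by (auto simp: Bloch_space_def)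
    then have "(1 - (norm z)\<^sup>2) * norm (deriv (T f) z) \<le> (SUP z\<in>unit_disk. (1 - (norm z)\<^sup>2) * norm (deriv (T f) z))"
      using z by (intro cSUP_upper)
    also have "\<dots> \<le> Bloch_norm (T f)" by (simp add: Bloch_norm_def)
    also have "\<dots> \<le> B" by (rule B[OF f])
    finally show ?thesis
      unfolding T_def using deriv_weighted_comp_op[OF \<psi> u hf] z by simp
  qed
  have both: "(1 - (norm z)\<^sup>2) * norm (deriv u z) /
             (\<phi> (norm (\<psi> z)) * (1 - (norm (\<psi> z))\<^sup>2) powr (1 / p)) \<le> B \<and>
    (1 - (norm z)\<^sup>2) * norm (u z * deriv \<psi> z) /
             (\<phi> (norm (\<psi> z)) * (1 - (norm (\<psi> z))\<^sup>2) powr (1 + 1 / p)) \<le> B"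
    if z: "z \<in> unit_disk" for z
  proof -
    have y1: "norm (\<psi> z) < 1" using z analytic_self_map_norm_less[OF \<psi>, of z] by auto
    have py: "\<phi> (norm (\<psi> z)) > 0" using normal_weight_pos[OF \<phi> _ y1] by simp
    obtain k h where kh: "k \<in> S" "h \<in> S"
      "k (\<psi> z) = of_real (1 / (\<phi> (norm (\<psi> z)) * (1 - (norm (\<psi> z))\<^sup>2) powr (1 / p)))" "deriv k (\<psi> z) = 0"
      "h (\<psi> z) = 0" "deriv h (\<psi> z) = of_real (1 / (\<phi> (norm (\<psi> z)) * (1 - (norm (\<psi> z))\<^sup>2) powr (1 + 1 / p)))"
      using M[OF y1] unfolding S_def by blast
    show ?thesis
      using main[OF kh(1) z] main[OF kh(2) z] py unfolding kh(3-)
      by (simp add: norm_mult norm_divide)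
  qed
  show "bdd_above ((\<lambda>z. (1 - (norm z)\<^sup>2) * norm (deriv u z) /
             (\<phi> (norm (\<psi> z)) * (1 - (norm (\<psi> z))\<^sup>2) powr (1 / p))) ` unit_disk)"
    using both by (intro bdd_aboveI2[of _ _ B]) blast
  show "bdd_above ((\<lambda>z. (1 - (norm z)\<^sup>2) * norm (u z * deriv \<psi> z) /
             (\<phi> (norm (\<psi> z)) * (1 - (norm (\<psi> z))\<^sup>2) powr (1 + 1 / p))) ` unit_disk)"
    using both by (intro bdd_aboveI2[of _ _ B]) blast
qed

theorem theorem3p1:
  fixes \<psi> u :: "complex \<Rightarrow> complex" and p :: real and \<phi> :: "real \<Rightarrow> real"
  assumes "analytic_self_map \<psi>"
    and "u holomorphic_on unit_disk"
    and "0 < p"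
    and "normal_weight \<phi>"
  shows "bounded_operator (Hpp_space p \<phi>) (Hpp_norm p \<phi>) Bloch_space Bloch_norm
           (weighted_comp_op u \<psi>) \<longleftrightarrow>
         bdd_above ((\<lambda>z. (1 - (norm z)\<^sup>2) * norm (deriv u z) /
             (\<phi> (norm (\<psi> z)) * (1 - (norm (\<psi> z))\<^sup>2) powr (1 / p))) ` unit_disk) \<and>
         bdd_above ((\<lambda>z. (1 - (norm z)\<^sup>2) * norm (u z * deriv \<psi> z) /
             (\<phi> (norm (\<psi> z)) * (1 - (norm (\<psi> z))\<^sup>2) powr (1 + 1 / p))) ` unit_disk)"
  by (intro iffI conjI weighted_comp_op_bounded_only_if[OF assms]; (elim conjE)?)
     (auto intro: weighted_comp_op_bounded_if[OF assms])

end
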